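(* If $G$ is a planar graph with girth at least $5$, then $G$ has an equitable $t$-tree-coloring for every integer $t\ge 3$; that is, $va^{\equiv}_{\infty,\infty}(G)\le 3$.
   Context: The girth of a graph is the length of a shortest cycle (infinite for forests). A $t$-coloring of $G$ is a map $f:V(G)\to\{1,\dots,t\}$ (not necessarily surjective) with color classes $V_i=f^{-1}(i)$; it is equitable if $||V_i|-|V_j||\le 1$ for all $i,j$. An equitable $t$-tree-coloring is an equitable $t$-coloring in which every color class induces a forest. $va^{\equiv}_{\infty,\infty}(G)$ is the smallest positive integer $t$ such that $G$ has an equitable $t'$-tree-coloring for every integer $t'\ge t$. *)

theory Defs
  imports "HOL-Analysis.Analysis" "HOL-Library.Extended_Nat"
begin

definition simple_graph :: "'a set \<Rightarrow> 'a set set \<Rightarrow> bool" where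
  "simple_graph V E \<longleftrightarrow> finite V \<and> (\<forall>e\<in>E. e \<subseteq> V \<and> card e = 2)"

text \<open>A cycle is the list of its vertices in cyclic order, without repetition of the first one,
  so the length of the list is the length of the cycle.\<close>

definition graph_cycle :: "'a set \<Rightarrow> 'a set set \<Rightarrow> 'a list \<Rightarrow> bool" where
  "graph_cycle V E c \<longleftrightarrow>
     3 \<le> length c \<and> distinct c \<and> set c \<subseteq> V \<and>
     (\<forall>i<length c. {c ! i, c ! (Suc i mod length c)} \<in> E)"

definition girth :: "'a set \<Rightarrow> 'a set set \<Rightarrow> enat" where
  "girth V E = Inf {enat (length c) | c. graph_cycle V E c}"

definition forest :: "'a set \<Rightarrow> 'a set set \<Rightarrow> bool" where
  "forest V E \<longleftrightarrow> (\<nexists>c. graph_cycle V E c)"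

definition induced_edges :: "'a set set \<Rightarrow> 'a set \<Rightarrow> 'a set set" where
  "induced_edges E S = {e \<in> E. e \<subseteq> S}"

text \<open>A drawing in the plane: vertices are distinct points, every edge is a simple arc joining
  its two ends and containing no other vertex, and two edges meet only in common ends.\<close>

definition plane_drawing ::
  "'a set \<Rightarrow> 'a set set \<Rightarrow> ('a \<Rightarrow> complex) \<Rightarrow> ('a set \<Rightarrow> real \<Rightarrow> complex) \<Rightarrow> bool" where
  "plane_drawing V E p \<gamma> \<longleftrightarrow>
     inj_on p V \<and>
     (\<forall>e\<in>E. arc (\<gamma> e) \<and> {pathstart (\<gamma> e), pathfinish (\<gamma> e)} = p ` e \<and>
             path_image (\<gamma> e) \<inter> p ` V = p ` e) \<and>
     (\<forall>e\<in>E. \<forall>e'\<in>E. e \<noteq> e' \<longrightarrow> path_image (\<gamma> e) \<inter> path_image (\<gamma> e') = p ` (e \<inter> e'))"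

definition planar :: "'a set \<Rightarrow> 'a set set \<Rightarrow> bool" where
  "planar V E \<longleftrightarrow> (\<exists>p \<gamma>. plane_drawing V E p \<gamma>)"

definition coloring :: "'a set \<Rightarrow> nat \<Rightarrow> ('a \<Rightarrow> nat) \<Rightarrow> bool" where
  "coloring V t f \<longleftrightarrow> f \<in> V \<rightarrow> {1..t}"

definition color_class :: "'a set \<Rightarrow> ('a \<Rightarrow> nat) \<Rightarrow> nat \<Rightarrow> 'a set" where
  "color_class V f i = {v \<in> V. f v = i}"

definition equitable_coloring :: "'a set \<Rightarrow> nat \<Rightarrow> ('a \<Rightarrow> nat) \<Rightarrow> bool" where
  "equitable_coloring V t f \<longleftrightarrow> coloring V t f \<and>
     (\<forall>i\<in>{1..t}. \<forall>j\<in>{1..t}.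
        \<bar>int (card (color_class V f i)) - int (card (color_class V f j))\<bar> \<le> 1)"

definition equitable_tree_coloring ::
  "'a set \<Rightarrow> 'a set set \<Rightarrow> nat \<Rightarrow> ('a \<Rightarrow> nat) \<Rightarrow> bool" where
  "equitable_tree_coloring V E t f \<longleftrightarrow> equitable_coloring V t f \<and>
     (\<forall>i\<in>{1..t}. forest (color_class V f i) (induced_edges E (color_class V f i)))"

definition va_equiv :: "'a set \<Rightarrow> 'a set set \<Rightarrow> nat" where
  "va_equiv V E =
     (LEAST t. 0 < t \<and> (\<forall>t'\<ge>t. \<exists>f. equitable_tree_coloring V E t' f))"

text \<open>The least element in \<^const>\<open>va_equiv\<close> exists for every finite graph, as enough
  colors allow pairwise distinct colors.\<close>

lemma va_equiv_exists:
  assumes "simple_graph V E"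
  shows "\<exists>t>0. \<forall>t'\<ge>t. \<exists>f. equitable_tree_coloring V E t' f"
proof (intro exI[of _ "Suc (card V)"] conjI allI impI)
  fix t assume t: "Suc (card V) \<le> t"
  have fin: "finite V" using assms by (simp add: simple_graph_def)
  have "card V \<le> card {1..t}" using t by simp
  then obtain f where f: "f ` V \<subseteq> {1..t}" "inj_on f V"
    using card_le_inj[OF fin, of "{1..t}"] by auto
  have le1: "card (color_class V f i) \<le> 1" for i
    unfolding color_class_def using f(2) fin
    by (auto simp: card_le_Suc0_iff_eq inj_on_def)
  have "forest (color_class V f i) F" for i F
    unfolding forest_def graph_cycle_def
  proof clarify
    fix c assume c: "3 \<le> length c" "distinct c" "set c \<subseteq> color_class V f i"
    have "card (set c) \<le> card (color_class V f i)"
      using c(3) fin by (intro card_mono) (auto simp: color_class_def)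
    then show False using c le1[of i] by (simp add: distinct_card)
  qed
  moreover have "\<bar>int (card (color_class V f i)) - int (card (color_class V f j))\<bar> \<le> 1" for i j
    using le1[of i] le1[of j] by linarith
  moreover have "coloring V t f"
    using f(1) by (auto simp: coloring_def)
  ultimately show "\<exists>f. equitable_tree_coloring V E t f"
    unfolding equitable_tree_coloring_def equitable_coloring_def by blast
qed simp

end

theory Submission
  imports Defs
begin

text \<open>
  Euler's formula gives \<open>3 |E(W)| < 5 |W|\<close> for every nonempty set \<open>W\<close> of vertices, and this sparsity
  together with the absence of triangles is all that is used of planarity and girth. The colouring
  is built by induction, removing a set \<open>S\<close> of \<open>t\<close> vertices and giving them \<open>t\<close> distinct colours
  afterwards. Colouring the vertices of \<open>S\<close> greedily works if the first one has at most 5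
  neighbours outside \<open>S\<close>, the last one at most 1 and the others at most 3. Sparsity makes every
  induced subgraph 3-degenerate, so only the first and the last vertex are a concern, and a
  discharging argument provides them: a vertex of degree at most 1, or one of degree 3 all of
  whose neighbours have degree at most 4, or a vertex of degree 2 with a neighbour \<open>y\<close> which has
  degree at most 6 or at most 3 neighbours of degree other than 2. In the last case \<open>y\<close> may have
  many neighbours outside \<open>S\<close>, but exchanging colours among those of degree 2 frees a colour
  for \<open>y\<close>.

  For the edge bound, faces are the components of the complement of the drawing. By Janiszewski's
  theorem every edge borders at most two faces and the complement of a drawn forest is connected,
  so that the edges bordering a face contain a cycle; by the Jordan curve theorem every edge
  outside a maximal forest contributes a new face.
\<close>

section \<open>Cycles and forests\<close>

definition nbs :: "'a set set \<Rightarrow> 'a set \<Rightarrow> 'a \<Rightarrow> 'a set" where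
  "nbs E X v = {w \<in> X. {v, w} \<in> E}"

lemma nbs_mono: "X \<subseteq> Y \<Longrightarrow> nbs E X v \<subseteq> nbs E Y v"
  by (auto simp: nbs_def)

lemma finite_nbs: "finite X \<Longrightarrow> finite (nbs E X v)"
  by (simp add: nbs_def)

text \<open>The two neighbours are the cyclic predecessor and successor, at the indices
  \<open>j\<close> and \<open>k\<close>. They differ because the cycle has at least three
  vertices.\<close>

lemma graph_cycle_two_nbs:
  assumes "graph_cycle X E c" "y \<in> set c"
  shows "\<exists>a b. a \<noteq> b \<and> a \<in> nbs E (set c) y \<and> b \<in> nbs E (set c) y"
proof -
  define L where "L = length c"
  have L: "3 \<le> L" and dist: "distinct c"
    and edge: "\<And>i. i < L \<Longrightarrow> {c ! i, c ! (Suc i mod L)} \<in> E"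
    using assms(1) by (auto simp: graph_cycle_def L_def)
  obtain i where i: "i < L" "c ! i = y"
    using assms(2) by (auto simp: in_set_conv_nth L_def)
  define j where "j = (if i = 0 then L - 1 else i - 1)"
  define k where "k = (if i = L - 1 then 0 else i + 1)"
  have jk: "j < L" "k < L" "j \<noteq> k" "Suc j mod L = i" "Suc i mod L = k"
    using i L by (auto simp: j_def k_def)
  have "c ! k \<in> nbs E (set c) y" "c ! j \<in> nbs E (set c) y"
    using edge[of i] edge[of j] jk i by (auto simp: nbs_def L_def insert_commute)
  moreover have "c ! j \<noteq> c ! k"
    using jk dist by (simp add: nth_eq_iff_index_eq L_def)
  ultimately show ?thesis by blast
qed

lemma forest_subset: "forest X E \<Longrightarrow> Y \<subseteq> X \<Longrightarrow> F \<subseteq> E \<Longrightarrow> forest Y F"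
  unfolding forest_def graph_cycle_def by (meson subset_trans subsetD)

text \<open>A cycle in \<open>X\<close> runs through vertices of \<open>X\<close> only, so its edges
  are induced anyway. All later arguments can therefore work with \<open>E\<close> itself.\<close>

lemma forest_induced: "forest X (induced_edges E X) \<longleftrightarrow> forest X E"
proof -
  have "graph_cycle X (induced_edges E X) c \<longleftrightarrow> graph_cycle X E c" for c
  proof -
    have "c ! (Suc i mod length c) \<in> set c" if "i < length c" for i
      using that by (intro nth_mem mod_less_divisor) linarith
    then show ?thesis
      unfolding graph_cycle_def induced_edges_def by (auto dest: nth_mem)
  qed
  then show ?thesis by (simp add: forest_def)
qed

text \<open>A cycle through some \<open>y\<close> in \<open>Y\<close> would give \<open>y\<close>
  two neighbours, so every cycle avoids \<open>Y\<close> and already lies in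
  \<open>X\<close>.\<close>

lemma forest_Un_leaves:
  assumes "forest X E" "finite (X \<union> Y)"
    and leaf: "\<And>y. y \<in> Y \<Longrightarrow> card (nbs E (X \<union> Y) y) \<le> 1"
  shows "forest (X \<union> Y) E"
  unfolding forest_def
proof
  assume "\<exists>c. graph_cycle (X \<union> Y) E c"
  then obtain c where c: "graph_cycle (X \<union> Y) E c" by blast
  have sub: "set c \<subseteq> X \<union> Y" using c by (simp add: graph_cycle_def)
  have "set c \<inter> Y = {}"
  proof (rule ccontr)
    assume "set c \<inter> Y \<noteq> {}"
    then obtain y where y: "y \<in> set c" "y \<in> Y" by blast
    obtain a b where "a \<noteq> b" "a \<in> nbs E (X \<union> Y) y" "b \<in> nbs E (X \<union> Y) y"
      using graph_cycle_two_nbs[OF c y(1)] nbs_mono[OF sub, of E y] by blast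
    then show False
      using leaf[OF y(2)] finite_nbs[OF assms(2), of E y] by (auto simp: card_le_Suc0_iff_eq)
  qed
  then have "graph_cycle X E c" using c sub by (auto simp: graph_cycle_def)
  then show False using assms(1) by (auto simp: forest_def)
qed

lemma forest_insert:
  assumes "forest X E" "finite X" "{y} \<notin> E" "card (nbs E X y) \<le> 1"
  shows "forest (insert y X) E"
proof -
  have "nbs E (X \<union> {y}) y = nbs E X y" using assms(3) by (auto simp: nbs_def)
  then show ?thesis using forest_Un_leaves[of X E "{y}"] assms by simp
qed

lemma forest_empty: "forest {} E"
  by (auto simp: forest_def graph_cycle_def)

lemma graph_cycleI:
  assumes "successively (\<lambda>x y. {x, y} \<in> E) c" "distinct c" "3 \<le> length c" "set c \<subseteq> V"
    and "{last c, hd c} \<in> E"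
  shows "graph_cycle V E c"
  unfolding graph_cycle_def
proof (intro conjI allI impI)
  fix i assume i: "i < length c"
  show "{c ! i, c ! (Suc i mod length c)} \<in> E"
  proof (cases "Suc i < length c")
    case True
    then show ?thesis using assms(1) by (simp add: successively_conv_nth)
  next
    case False
    then have "i = length c - 1" "Suc i mod length c = 0" using i by (auto simp: mod_Suc)
    moreover have "c \<noteq> []" using assms(3) by auto
    ultimately have "c ! i = last c" "c ! (Suc i mod length c) = hd c"
      by (simp_all add: last_conv_nth hd_conv_nth)
    then show ?thesis using assms(5) by simp
  qed
qed (use assms in auto)

text \<open>In a longest path all neighbours of the first vertex lie on the path; one that is not
  the second vertex closes a cycle.\<close>

lemma exists_graph_cycle:
  assumes fin: "finite V" and ne: "V \<noteq> {}" and noloop: "\<And>x. {x} \<notin> E"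
    and deg: "\<And>v. v \<in> V \<Longrightarrow> 2 \<le> card (nbs E V v)"
  shows "\<exists>c. graph_cycle V E c"
proof -
  define P where "P xs \<longleftrightarrow> xs \<noteq> [] \<and> distinct xs \<and> set xs \<subseteq> V \<and>
    successively (\<lambda>x y. {x, y} \<in> E) xs" for xs
  have bound: "length xs < Suc (card V)" if "P xs" for xs
    using that card_mono[OF fin, of "set xs"] by (auto simp: P_def distinct_card less_Suc_eq_le)
  obtain v where "v \<in> V" using ne by blast
  then have "P [v]" by (simp add: P_def)
  then obtain xs where xs: "P xs" and max: "\<And>ys. P ys \<Longrightarrow> length ys \<le> length xs"
    using bound by (metis ex_has_greatest_nat)
  define x where "x = hd xs"
  have x: "x \<in> V" "xs \<noteq> []" using xs by (auto simp: P_def x_def)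
  have in_xs: "w \<in> set xs" if "w \<in> nbs E V x" for w
  proof (rule ccontr)
    assume "w \<notin> set xs"
    then have "P (w # xs)"
      using xs that unfolding P_def x_def by (cases xs) (auto simp: nbs_def insert_commute)
    then show False using max[of "w # xs"] by simp
  qed
  \<comment> \<open>Two neighbours do not fit into any singleton, so this holds even if
    \<open>xs\<close> has one entry and \<open>xs ! 1\<close> is meaningless.\<close>
  have "\<not> nbs E V x \<subseteq> {xs ! 1}"
    using deg[OF x(1)] card_mono[of "{xs ! 1}" "nbs E V x"] by auto
  then obtain w where w: "w \<in> nbs E V x" "w \<noteq> xs ! 1" by blast
  obtain j where j: "j < length xs" "xs ! j = w"
    using in_xs[OF w(1)] by (auto simp: in_set_conv_nth)
  have "j \<noteq> 0"
    using w(1) j noloop[of x] x(2) by (intro notI) (simp add: nbs_def x_def hd_conv_nth)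
  moreover have "j \<noteq> 1" using w(2) j by auto
  ultimately have j2: "2 \<le> j" by linarith
  have "graph_cycle V E (take (Suc j) xs)"
  proof (rule graph_cycleI)
    show "successively (\<lambda>x y. {x, y} \<in> E) (take (Suc j) xs)"
      using xs by (auto simp: P_def successively_conv_nth)
    show "set (take (Suc j) xs) \<subseteq> V" using xs set_take_subset[of "Suc j" xs] by (auto simp: P_def)
    have "last (take (Suc j) xs) = w" "hd (take (Suc j) xs) = x"
      using j by (simp add: take_Suc_conv_app_nth) (simp add: x_def)
    then show "{last (take (Suc j) xs), hd (take (Suc j) xs)} \<in> E"
      using w(1) by (simp add: nbs_def insert_commute)
  qed (use xs j j2 in \<open>auto simp: P_def\<close>)
  then show ?thesis by blast
qed

section \<open>Degrees and edge counts of forests and cycles\<close>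

lemma simple_graph_no_loop: "simple_graph V E \<Longrightarrow> {x} \<notin> E"
  by (auto simp: simple_graph_def)

lemma simple_graph_finite_edges: "simple_graph V E \<Longrightarrow> finite E"
  unfolding simple_graph_def by (meson finite_Pow_iff finite_subset PowI subsetI)

lemma simple_graph_subset: "simple_graph V E \<Longrightarrow> A \<subseteq> E \<Longrightarrow> simple_graph V A"
  by (auto simp: simple_graph_def)

lemma incident_edges:
  assumes "simple_graph V E"
  shows "{e \<in> E. v \<in> e} = (\<lambda>w. {v, w}) ` nbs E V v"
proof
  show "{e \<in> E. v \<in> e} \<subseteq> (\<lambda>w. {v, w}) ` nbs E V v"
  proof
    fix e assume e: "e \<in> {e \<in> E. v \<in> e}"
    then have "card e = 2" "e \<subseteq> V" using assms by (auto simp: simple_graph_def)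
    then obtain w where "e = {v, w}" using e by (auto simp: card_2_iff)
    then show "e \<in> (\<lambda>w. {v, w}) ` nbs E V v"
      using e \<open>e \<subseteq> V\<close> by (auto simp: nbs_def)
  qed
qed (auto simp: nbs_def)

lemma card_incident_edges:
  assumes "simple_graph V E"
  shows "card {e \<in> E. v \<in> e} = card (nbs E V v)"
  unfolding incident_edges[OF assms]
  by (rule card_image) (auto simp: inj_on_def doubleton_eq_iff)

text \<open>Induction, deleting a vertex of degree at most 1. The bound is one above the optimum for
  nonempty \<open>V\<close>, which the strict inequality of \<open>edge_bound\<close>
  tolerates.\<close>

lemma forest_card_edges_le:
  assumes "simple_graph V E" "forest V E"
  shows "card E \<le> card V"
  using assms
proof (induction "card V" arbitrary: V E)
  case 0
  then have "E = {}" by (fastforce simp: simple_graph_def)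
  then show ?case by simp
next
  case (Suc n)
  have fin: "finite V" "V \<noteq> {}" using Suc by (auto simp: simple_graph_def)
  then obtain v where v: "v \<in> V" "card (nbs E V v) \<le> 1"
    using exists_graph_cycle[OF fin, of E] Suc.prems simple_graph_no_loop[OF Suc.prems(1)]
    unfolding forest_def by (metis not_less_eq_eq numeral_2_eq_2 One_nat_def)
  define F where "F = {e \<in> E. v \<notin> e}"
  have sg: "simple_graph (V - {v}) F" using Suc.prems(1) by (auto simp: simple_graph_def F_def)
  have fo: "forest (V - {v}) F"
    using Suc.prems(2) by (rule forest_subset) (auto simp: F_def)
  have "n = card (V - {v})" using fin v(1) Suc.hyps(2) by simp
  then have "card F \<le> card (V - {v})" using sg fo by (rule Suc.hyps(1))
  moreover have "card E = card F + card {e \<in> E. v \<in> e}"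
    unfolding F_def using simple_graph_finite_edges[OF Suc.prems(1)]
    by (subst card_Un_disjoint[symmetric]) (auto intro: arg_cong[where f = card])
  ultimately show ?case
    using v fin card_incident_edges[OF Suc.prems(1), of v] Suc.hyps(2) by simp
qed

text \<open>If two positions carried the same edge, each would be the cyclic successor of the other,
  which forces length at most 2.\<close>

lemma graph_cycle_inj_edges:
  assumes "graph_cycle V E c"
  shows "inj_on (\<lambda>i. {c ! i, c ! (Suc i mod length c)}) {..<length c}"
proof (rule inj_onI, rule ccontr)
  define L where "L = length c"
  have L: "3 \<le> L" and dist: "distinct c"
    using assms(1) by (auto simp: graph_cycle_def L_def)
  fix i j assume ij: "i \<in> {..<length c}" "j \<in> {..<length c}" "i \<noteq> j"
    and eq: "{c ! i, c ! (Suc i mod length c)} = {c ! j, c ! (Suc j mod length c)}"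
  have "Suc i mod L < L" "Suc j mod L < L" using L by auto
  then have "i = Suc j mod L" "j = Suc i mod L"
    using eq ij dist unfolding L_def by (auto simp: doubleton_eq_iff nth_eq_iff_index_eq)
  moreover have "Suc k mod L = 0 \<and> Suc k = L \<or> Suc k mod L = Suc k" if "k < L" for k
    using that by (cases "Suc k = L") auto
  ultimately have "Suc j = L \<and> i = 0 \<or> i = Suc j" "Suc i = L \<and> j = 0 \<or> j = Suc i"
    using ij by (metis L_def lessThan_iff)+
  then show False using L by linarith
qed

lemma graph_cycle_length_le:
  assumes "graph_cycle V E c" "finite E"
  shows "length c \<le> card E"
proof -
  have "card {..<length c} \<le> card E"
    using assms graph_cycle_inj_edges[OF assms(1)]
    by (intro card_inj_on_le[where f = "\<lambda>i. {c ! i, c ! (Suc i mod length c)}"])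
      (auto simp: graph_cycle_def)
  then show ?thesis by simp
qed

section \<open>Reachability, and cycles closed by one extra edge\<close>

abbreviation joined :: "'a set set \<Rightarrow> ('a \<times> 'a) set" where
  "joined A \<equiv> {(x, y). {x, y} \<in> A}\<^sup>*"

lemma joined_sym: "(x, y) \<in> joined A \<Longrightarrow> (y, x) \<in> joined A"
  by (rule symD[OF sym_rtrancl]) (auto simp: sym_def insert_commute)

lemma joined_distinct_path:
  assumes "(u, v) \<in> joined A"
  shows "\<exists>xs. xs \<noteq> [] \<and> hd xs = u \<and> last xs = v \<and> distinct xs \<and> successively (\<lambda>x y. {x, y} \<in> A) xs"
  using assms
proof (induction rule: rtrancl_induct)
  case base
  show ?case by (intro exI[of _ "[u]"]) simp
next
  case (step y z)
  then obtain xs where xs: "xs \<noteq> []" "hd xs = u" "last xs = y" "distinct xs"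
    "successively (\<lambda>x y. {x, y} \<in> A) xs" by blast
  show ?case
  \<comment> \<open>If the walk returns to a vertex \<open>z\<close> of the path, the path is cut
    off at \<open>z\<close>.\<close>
  proof (cases "z \<in> set xs")
    case True
    then obtain ys zs where split: "xs = ys @ z # zs" by (meson split_list)
    then have "hd (ys @ [z]) = u" using xs(2) by (cases ys) auto
    then show ?thesis
      using xs split by (intro exI[of _ "ys @ [z]"]) (auto simp: successively_append_iff)
  next
    case False
    then show ?thesis
      using xs step(2) by (intro exI[of _ "xs @ [z]"]) (auto simp: successively_append_iff)
  qed
qed

text \<open>A repetition-free path from \<open>u\<close> to \<open>v\<close> in \<open>A\<close> is
  closed by the new edge. It has at least three vertices since \<open>u\<close> and \<open>v\<close>
  are distinct and not adjacent in \<open>A\<close>.\<close>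

lemma graph_cycle_if_joined:
  assumes "simple_graph V (insert {u, v} A)" "{u, v} \<notin> A" "(u, v) \<in> joined A"
  shows "\<exists>c. graph_cycle V (insert {u, v} A) c"
proof -
  have uv: "u \<noteq> v" "u \<in> V" using assms(1) by (auto simp: simple_graph_def)
  obtain xs where xs: "xs \<noteq> []" "hd xs = u" "last xs = v" "distinct xs"
    "successively (\<lambda>x y. {x, y} \<in> A) xs"
    using joined_distinct_path[OF assms(3)] by blast
  have len: "3 \<le> length xs"
  proof (rule ccontr)
    assume "\<not> 3 \<le> length xs"
    then consider x where "xs = [x]" | x y where "xs = [x, y]"
      using xs(1) by (cases xs; cases "tl xs"; cases "tl (tl xs)") auto
    then show False using xs uv assms(2) by cases auto
  qed
  have "x \<in> V" if x: "x \<in> set xs" for x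
  proof -
    obtain i where i: "i < length xs" "x = xs ! i" using x by (auto simp: in_set_conv_nth)
    show ?thesis
    proof (cases i)
      case 0
      then show ?thesis using i xs(1,2) uv by (simp add: hd_conv_nth)
    next
      case (Suc j)
      then have "{xs ! j, xs ! i} \<in> A" using i xs(5) by (simp add: successively_conv_nth)
      then show ?thesis using assms(1) i by (auto simp: simple_graph_def)
    qed
  qed
  moreover have "successively (\<lambda>x y. {x, y} \<in> insert {u, v} A) xs"
    using xs(5) by (rule successively_mono) auto
  ultimately have "graph_cycle V (insert {u, v} A) xs"
    using xs len by (intro graph_cycleI) (auto simp: insert_commute)
  then show ?thesis by blast
qed

text \<open>The cycle must use the new edge, exactly once; the rest of the cycle joins its ends
  within \<open>A\<close>.\<close>

lemma joined_if_graph_cycle: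
  assumes "forest V A" "graph_cycle V (insert {u, v} A) c"
  shows "(u, v) \<in> joined A"
proof -
  define L where "L = length c"
  define k where "k i = i mod L" for i
  have L: "3 \<le> L" and edge: "\<And>i. i < L \<Longrightarrow> {c ! i, c ! k (Suc i)} \<in> insert {u, v} A"
    using assms(2) by (auto simp: graph_cycle_def L_def k_def)
  have "\<not> graph_cycle V A c" using assms(1) by (simp add: forest_def)
  then have "\<exists>i<L. {c ! i, c ! k (Suc i)} \<notin> A"
    using assms(2) by (auto simp: graph_cycle_def L_def k_def)
  then obtain i where i: "i < L" "{c ! i, c ! k (Suc i)} = {u, v}"
    using edge by blast
  have other: "{c ! j, c ! k (Suc j)} \<in> A" if "j < L" "j \<noteq> i" for j
    using edge[OF that(1)] inj_onD[OF graph_cycle_inj_edges[OF assms(2)], of i j] i that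
    by (auto simp: L_def k_def)
  \<comment> \<open>Walk round the cycle from the far end of the new edge. Position \<open>i\<close>
    would be met again only when \<open>L\<close> divides \<open>Suc n\<close>, so all edges used
    before that lie in \<open>A\<close>.\<close>
  have "(c ! k (Suc i), c ! k (Suc i + n)) \<in> joined A" if "n < L" for n
    using that
  proof (induction n)
    case (Suc n)
    have "k (Suc i + n) \<noteq> i"
    proof
      assume "k (Suc i + n) = i"
      then have "(Suc i + n) mod L = i mod L" using i(1) by (simp add: k_def)
      then have "L dvd Suc n" using mod_eq_dvd_iff_nat[of i "Suc i + n" L] by simp
      then show False using Suc.prems by (auto dest: dvd_imp_le)
    qed
    moreover have "k (Suc i + n) < L" using L by (simp add: k_def)
    ultimately have "{c ! k (Suc i + n), c ! k (Suc (k (Suc i + n)))} \<in> A"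
      using other by blast
    moreover have "k (Suc (k (Suc i + n))) = k (Suc i + Suc n)" by (simp add: k_def mod_Suc_eq)
    ultimately show ?case using Suc by (auto intro: rtrancl_into_rtrancl)
  qed simp
  from this[of "L - 1"] have "(c ! k (Suc i), c ! i) \<in> joined A"
    using L i(1) by (simp add: k_def)
  then show ?thesis using i(2) joined_sym by (fastforce simp: doubleton_eq_iff)
qed

section \<open>Tree colourings of sparse graphs\<close>

text \<open>Equitability is left out: the sizes of the colour classes are tracked separately when a
  colouring is extended.\<close>

definition tree_coloring :: "'a set set \<Rightarrow> nat \<Rightarrow> 'a set \<Rightarrow> ('a \<Rightarrow> nat) \<Rightarrow> bool" where
  "tree_coloring E t X f \<longleftrightarrow>
     coloring X t f \<and> (\<forall>i\<in>{1..t}. forest (color_class X f i) E)"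

section \<open>Extending a colouring by one new vertex of each colour\<close>

lemma finite_color_class: "finite X \<Longrightarrow> finite (color_class X f i)"
  by (simp add: color_class_def)

text \<open>When a vertex is treated, at least two colours of \<open>C\<close> are still free, and
  its at most three neighbours in \<open>X\<close> cannot occur twice in both. Adjacency within
  \<open>M\<close> is harmless, as the colours on \<open>M\<close> are distinct.\<close>

lemma assign_colors:
  assumes "finite M" "finite C" "finite X" "card M < card C"
    and "\<And>m. m \<in> M \<Longrightarrow> card (nbs E X m) \<le> 3"
  shows "\<exists>g. inj_on g M \<and> g ` M \<subseteq> C \<and> (\<forall>m\<in>M. card (nbs E (color_class X f (g m)) m) \<le> 1)"
  using assms(1,4,5)
proof (induction M rule: finite_induct)
  case empty
  then show ?case by simp
next
  case (insert m M)
  then obtain g where g: "inj_on g M" "g ` M \<subseteq> C"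
    "\<forall>m\<in>M. card (nbs E (color_class X f (g m)) m) \<le> 1" by fastforce
  have "2 \<le> card (C - g ` M)"
    using insert g assms(2) by (simp add: card_Diff_subset card_image)
  then obtain D where "D \<subseteq> C - g ` M" "card D = 2" by (meson obtain_subset_with_card_n)
  then obtain c d where cd: "c \<in> C - g ` M" "d \<in> C - g ` M" "c \<noteq> d"
    by (auto simp: card_2_iff)
  define N where "N i = nbs E (color_class X f i) m" for i
  have fin: "finite (N i)" for i
    using assms(3) by (simp add: N_def finite_nbs finite_color_class)
  have "card (N c) + card (N d) = card (N c \<union> N d)"
    using cd(3) fin by (intro card_Un_disjoint[symmetric]) (auto simp: N_def nbs_def color_class_def)
  also have "\<dots> \<le> card (nbs E X m)"
    using assms(3) by (intro card_mono finite_nbs) (auto simp: N_def nbs_def color_class_def)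
  also have "\<dots> \<le> 3" using insert.prems by simp
  finally have "card (N c) \<le> 1 \<or> card (N d) \<le> 1" by linarith
  then obtain b where b: "b \<in> C - g ` M" "card (N b) \<le> 1" using cd by blast
  show ?case
    using g b insert.hyps(2) by (intro exI[of _ "g(m := b)"]) (auto simp: inj_on_def N_def)
qed

text \<open>Every class gains exactly one vertex, so the differences between class sizes do not
  change.\<close>

lemma extend_by_transversal:
  assumes "finite X" "S \<inter> X = {}" "tree_coloring E t X f" "bij_betw g S {1..t}"
    and forest: "\<And>s. s \<in> S \<Longrightarrow> forest (insert s (color_class X f (g s))) E"
  shows "\<exists>h. tree_coloring E t (X \<union> S) h \<and>
    (\<forall>i\<in>{1..t}. card (color_class (X \<union> S) h i) = Suc (card (color_class X f i)))"
proof -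
  define h where "h x = (if x \<in> S then g x else f x)" for x
  have cls: "\<exists>s\<in>S. g s = i \<and> color_class (X \<union> S) h i = insert s (color_class X f i)"
    if i: "i \<in> {1..t}" for i
  proof -
    obtain s where s: "s \<in> S" "g s = i"
      using i unfolding bij_betw_imp_surj_on[OF assms(4), symmetric] by blast
    have "s' = s" if "s' \<in> S" "g s' = i" for s'
      using inj_onD[OF bij_betw_imp_inj_on[OF assms(4)], of s' s] that s by simp
    then have "color_class (X \<union> S) h i = insert s (color_class X f i)"
      using s(1) assms(2) unfolding color_class_def h_def s(2)[symmetric] by (auto simp: disjoint_iff)
    then show ?thesis using s by blast
  qed
  have "g s \<in> {1..t}" if "s \<in> S" for s
    using bij_betw_apply[OF assms(4) that] .
  moreover have "f \<in> X \<rightarrow> {1..t}"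
    using assms(3) by (simp add: tree_coloring_def coloring_def)
  ultimately have "coloring (X \<union> S) t h"
    unfolding coloring_def h_def by (simp add: Pi_iff ball_Un)
  moreover have "forest (color_class (X \<union> S) h i) E" if i: "i \<in> {1..t}" for i
  proof -
    obtain s where "s \<in> S" "g s = i" "color_class (X \<union> S) h i = insert s (color_class X f i)"
      using cls[OF i] by blast
    then show ?thesis using forest[of s] by simp
  qed
  ultimately have "tree_coloring E t (X \<union> S) h" by (simp add: tree_coloring_def)
  moreover have "card (color_class (X \<union> S) h i) = Suc (card (color_class X f i))"
    if i: "i \<in> {1..t}" for i
  proof -
    obtain s where s: "s \<in> S" "color_class (X \<union> S) h i = insert s (color_class X f i)"
      using cls[OF i] by blast
    moreover have "s \<notin> color_class X f i" using s(1) assms(2) by (auto simp: color_class_def)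
    ultimately show ?thesis using finite_color_class[OF assms(1)] by simp
  qed
  ultimately show ?thesis by blast
qed

text \<open>The vertex \<open>a\<close> takes the prescribed colour \<open>c\<close>, the vertices
  of \<open>M\<close> are coloured greedily from the others, and \<open>v\<close> takes the one
  colour \<open>d\<close> left over, which is safe as \<open>v\<close> has at most one neighbour in
  \<open>X\<close>.\<close>

lemma extend_tree_coloring:
  assumes "finite X" "finite S" "S \<inter> X = {}" "card S = t" "a \<in> S" "v \<in> S" "a \<noteq> v"
    and noloop: "\<And>x. {x} \<notin> E"
    and f: "tree_coloring E t X f" and c: "c \<in> {1..t}" "forest (insert a (color_class X f c)) E"
    and v: "card (nbs E X v) \<le> 1"
    and rest: "\<And>m. m \<in> S - {a, v} \<Longrightarrow> card (nbs E X m) \<le> 3"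
  shows "\<exists>h. tree_coloring E t (X \<union> S) h \<and>
    (\<forall>i\<in>{1..t}. card (color_class (X \<union> S) h i) = Suc (card (color_class X f i)))"
proof -
  define M where "M = S - {a, v}"
  define C where "C = {1..t} - {c}"
  have S: "S = insert a (insert v M)" using assms(5,6) by (auto simp: M_def)
  have M: "finite M" "a \<notin> M" "v \<notin> M" using assms(2) by (auto simp: M_def)
  have cards: "card S = card M + 2" "card C + 1 = t"
    using M assms(7) c(1) unfolding S C_def by auto
  then have "card M < card C" using assms(4) by linarith
  then obtain g where g: "inj_on g M" "g ` M \<subseteq> C"
    "\<forall>m\<in>M. card (nbs E (color_class X f (g m)) m) \<le> 1"
    using assign_colors[of M C X E f] assms(1,2) rest by (auto simp: M_def C_def)
  have "card (g ` M) < card C" using \<open>card M < card C\<close> g(1) by (simp add: card_image)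
  then have "\<not> C \<subseteq> g ` M"
    using M(1) by (metis card_mono finite_imageI not_less)
  then obtain d where d: "d \<in> C" "d \<notin> g ` M" by blast
  define k where "k = g(a := c, v := d)"
  have k: "k a = c" "k v = d" "\<And>m. m \<in> M \<Longrightarrow> k m = g m"
    using assms(7) M by (auto simp: k_def)
  have kM: "k ` M = g ` M" "inj_on k M"
    using k(3) g(1) by (auto simp: inj_on_def)
  have C: "c \<notin> C" "C \<subseteq> {1..t}" by (auto simp: C_def)
  have "d \<notin> k ` M" "c \<noteq> d" "c \<notin> k ` M" using d kM g(2) C by auto
  then have "inj_on k S"
    unfolding S inj_on_insert using kM k(1,2) M assms(7) by (simp add: insert_Diff_if)
  moreover have "k ` S \<subseteq> {1..t}"
    unfolding S image_insert kM k(1,2) using g(2) d(1) c(1) C by blast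
  ultimately have bij: "bij_betw k S {1..t}"
    using assms(4) by (simp add: bij_betw_def card_image card_subset_eq)
  have fo: "forest (insert s (color_class X f i)) E"
    if "i \<in> {1..t}" "card (nbs E (color_class X f i) s) \<le> 1" for s i
    using f that assms(1) noloop by (intro forest_insert finite_color_class) (auto simp: tree_coloring_def)
  have "card (nbs E (color_class X f d) v) \<le> card (nbs E X v)"
    using assms(1) by (intro card_mono finite_nbs nbs_mono) (auto simp: color_class_def)
  then have "forest (insert v (color_class X f d)) E"
    using d v by (intro fo) (auto simp: C_def)
  moreover have "forest (insert m (color_class X f (g m))) E" if "m \<in> M" for m
    using g that by (intro fo) (auto simp: C_def)
  ultimately have "forest (insert s (color_class X f (k s))) E" if "s \<in> S" for s
    using that c k unfolding S by auto
  then show ?thesis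
    using extend_by_transversal[OF assms(1,3) f bij] by blast
qed

text \<open>Among three colours, at most five neighbours leave one that occurs at most once, so
  \<open>a\<close> becomes a leaf or an isolated vertex in that class.\<close>

lemma free_color:
  assumes "finite X" "3 \<le> t" "\<And>x. {x} \<notin> E" "tree_coloring E t X f" "card (nbs E X a) \<le> 5"
  shows "\<exists>c\<in>{1..t}. forest (insert a (color_class X f c)) E"
proof -
  define N where "N i = nbs E (color_class X f i) a" for i
  have fin: "finite (N i)" for i
    using assms(1) by (simp add: N_def finite_nbs finite_color_class)
  have disj: "N i \<inter> N j = {}" if "i \<noteq> j" for i j
    using that by (auto simp: N_def nbs_def color_class_def)
  have "card (N 1) + card (N 2) + card (N 3) = card (N 1 \<union> N 2 \<union> N 3)"
    using fin by (simp add: card_Un_disjoint disj Int_Un_distrib2)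
  also have "\<dots> \<le> card (nbs E X a)"
    using assms(1) by (intro card_mono finite_nbs) (auto simp: N_def nbs_def color_class_def)
  finally have "card (N 1) \<le> 1 \<or> card (N 2) \<le> 1 \<or> card (N 3) \<le> 1" using assms(5) by linarith
  moreover have "{1, 2, 3} \<subseteq> {1..t}" using assms(2) by auto
  ultimately obtain c where c: "c \<in> {1..t}" "card (N c) \<le> 1" by blast
  then have "forest (insert a (color_class X f c)) E"
    using assms by (intro forest_insert finite_color_class) (auto simp: tree_coloring_def N_def)
  then show ?thesis using c by blast
qed

text \<open>\<open>B i\<close> consists of the neighbours of \<open>a\<close> of colour \<open>i\<close> whose only further neighbour has colour
  \<open>i\<close> as well. Exchanging \<open>B c\<close> with equally many elements of \<open>B d\<close> isolates the former in their
  new class, while the latter become leaves hanging at \<open>a\<close>.\<close>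

lemma swap_colors:
  assumes X: "finite X" "a \<notin> X" and noloop: "\<And>x. {x} \<notin> E"
    and f: "tree_coloring E t X f" and cd: "c \<in> {1..t}" "d \<in> {1..t}" "c \<noteq> d"
    and indep: "\<And>v w. v \<in> nbs E X a \<Longrightarrow> w \<in> nbs E X a \<Longrightarrow> {v, w} \<notin> E"
    and Q: "Q = {w \<in> nbs E X a. card (nbs E X w) \<le> 1}"
    and few: "card (nbs E (color_class X f c) a - Q) \<le> 1"
    and B: "\<And>i. B i = {w \<in> Q. f w = i \<and> nbs E (color_class X f i) w \<noteq> {}}"
    and le: "card (B c) \<le> card (B d)"
  shows "\<exists>h. tree_coloring E t X h \<and> (\<forall>i. card (color_class X h i) = card (color_class X f i)) \<and>
    forest (insert a (color_class X h c)) E"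
proof -
  obtain D where D: "D \<subseteq> B d" "card D = card (B c)"
    using le by (meson obtain_subset_with_card_n)
  have QX: "Q \<subseteq> nbs E X a" "nbs E X a \<subseteq> X" by (auto simp: Q nbs_def)
  have BQ: "B i \<subseteq> Q" "B i \<subseteq> color_class X f i" for i
    using QX by (auto simp: B color_class_def)
  have disj: "color_class X f i \<inter> color_class X f j = {}" if "i \<noteq> j" for i j
    using that by (auto simp: color_class_def)
  have fin: "finite (color_class X f i)" "finite (B i)" for i
    using X(1) finite_color_class finite_subset[OF BQ(2)] by blast+
  have finD: "finite D" using D(1) fin finite_subset by blast
  define h where "h x = (if x \<in> B c then d else if x \<in> D then c else f x)" for x
  have Dd: "D \<subseteq> color_class X f d" "D \<inter> color_class X f c = {}" "D \<inter> B c = {}"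
    using D(1) BQ(2)[of d] BQ(2)[of c] disj[OF cd(3)] by blast+
  have hc: "color_class X h c = (color_class X f c - B c) \<union> D"
    using cd(3) Dd by (auto simp: color_class_def h_def)
  have hd: "color_class X h d = (color_class X f d - D) \<union> B c"
    using cd(3) BQ(2)[of c] Dd by (auto simp: color_class_def h_def)
  have hi: "color_class X h i = color_class X f i" if "i \<noteq> c" "i \<noteq> d" for i
  proof -
    have "x \<in> B c \<Longrightarrow> f x = c" "x \<in> D \<Longrightarrow> f x = d" for x
      using BQ(2)[of c] Dd(1) by (auto simp: color_class_def)
    then show ?thesis using that by (auto simp: color_class_def h_def)
  qed
  have card_le: "card D \<le> card (color_class X f d)" "card (B c) \<le> card (color_class X f c)"
    by (rule card_mono[OF fin(1) Dd(1)], rule card_mono[OF fin(1) BQ(2)])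
  have "card (color_class X h c) = card (color_class X f c)"
    unfolding hc using fin finD Dd(2) BQ(2)[of c] D(2) card_le
    by (subst card_Un_disjoint) (auto simp: card_Diff_subset)
  moreover have "card (color_class X h d) = card (color_class X f d)"
    unfolding hd using fin finD Dd(1) BQ(2)[of c] disj[OF cd(3)] D(2) card_le
    by (subst card_Un_disjoint) (auto simp: card_Diff_subset)
  ultimately have cards: "card (color_class X h i) = card (color_class X f i)" for i
    using hi[of i] by (cases "i = c"; cases "i = d") auto
  \<comment> \<open>The single neighbour of a vertex of \<open>B i\<close> has colour
    \<open>i\<close>, so the vertex sees nothing in the other old classes.\<close>
  have only: "nbs E X w \<inter> color_class X f j = {}" if "w \<in> B i" "i \<noteq> j" for w i j
  proof -
    have "card (nbs E X w) \<le> 1" "nbs E (color_class X f i) w \<noteq> {}"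
      using that(1) by (auto simp: B Q)
    then obtain z where "z \<in> nbs E X w" "z \<in> color_class X f i"
      by (auto simp: nbs_def color_class_def)
    moreover have "z' = z" if "z' \<in> nbs E X w" for z'
      using \<open>card (nbs E X w) \<le> 1\<close> that \<open>z \<in> nbs E X w\<close> finite_nbs[OF X(1), of E w]
      by (auto simp: card_le_Suc0_iff_eq)
    ultimately show ?thesis using disj[OF that(2)] by blast
  qed
  have QQ: "{v, w} \<notin> E" if "v \<in> Q" "w \<in> Q" for v w
    using that QX(1) indep by blast
  have ffo: "forest (color_class X f i) E" if "i \<in> {1..t}" for i
    using f that by (simp add: tree_coloring_def)
  have forest_d: "forest (color_class X h d) E"
    unfolding hd
  proof (rule forest_Un_leaves)
    show "forest (color_class X f d - D) E"
      using ffo[OF cd(2)] by (rule forest_subset) auto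
    show "finite (color_class X f d - D \<union> B c)" using fin by simp
    fix y assume y: "y \<in> B c"
    have "nbs E (color_class X f d - D \<union> B c) y \<subseteq> nbs E X y \<inter> color_class X f d"
      using QQ[of y] BQ(1)[of c] y by (auto simp: nbs_def color_class_def)
    then have "nbs E (color_class X f d - D \<union> B c) y = {}" using only[OF y cd(3)] by blast
    then show "card (nbs E (color_class X f d - D \<union> B c) y) \<le> 1" by simp
  qed
  have forest_c: "forest (insert a (color_class X h c)) E"
  proof -
    \<comment> \<open>The vertices of \<open>Q\<close> in the new class \<open>c\<close>. None has a
      neighbour in the old class \<open>c\<close>, and \<open>Q\<close> is independent, so in the
      enlarged class each can be adjacent only to \<open>a\<close>.\<close>
    define Y where "Y = (color_class X f c \<inter> Q - B c) \<union> D"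
    have split: "insert a (color_class X h c) = insert a (color_class X f c - Q) \<union> Y"
      unfolding hc Y_def using BQ(1)[of c] by blast
    have "nbs E (color_class X f c - Q) a = nbs E (color_class X f c) a - Q"
      by (auto simp: nbs_def)
    then have "forest (insert a (color_class X f c - Q)) E"
      using few noloop fin forest_subset[OF ffo[OF cd(1)], of "color_class X f c - Q" E]
      by (intro forest_insert) auto
    moreover have "card (nbs E (insert a (color_class X f c - Q) \<union> Y) y) \<le> 1" if y: "y \<in> Y" for y
    proof -
      have YQ: "Y \<subseteq> Q" using D(1) BQ(1)[of d] by (auto simp: Y_def)
      have "nbs E X y \<inter> color_class X f c = {}"
      proof (cases "y \<in> D")
        case True
        then show ?thesis using only[of y d c] D(1) cd(3) by blast
      next
        case False
        then have "y \<in> Q" "f y = c" "y \<notin> B c" using y by (auto simp: Y_def color_class_def)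
        then show ?thesis by (auto simp: B nbs_def color_class_def)
      qed
      moreover have "nbs E (insert a (color_class X f c - Q) \<union> Y) y
          \<subseteq> insert a (nbs E X y \<inter> color_class X f c)"
        using QQ[of y] YQ y by (auto simp: nbs_def color_class_def)
      ultimately show ?thesis using card_mono[of "{a}"] by fastforce
    qed
    moreover have "finite (insert a (color_class X f c - Q) \<union> Y)"
      using fin finD by (simp add: Y_def)
    ultimately show ?thesis unfolding split using forest_Un_leaves by blast
  qed
  have "forest (color_class X h i) E" if "i \<in> {1..t}" for i
  proof -
    consider "i = c" | "i = d" | "i \<noteq> c" "i \<noteq> d" by blast
    then show ?thesis
    proof cases
      case 1
      then show ?thesis using forest_subset[OF forest_c] by blast
    next
      case 2
      then show ?thesis using forest_d by simp
    next
      case 3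
      then show ?thesis using hi ffo[OF that] by simp
    qed
  qed
  moreover have "coloring X t h"
    using f cd by (simp add: tree_coloring_def coloring_def h_def Pi_iff)
  ultimately have "tree_coloring E t X h" by (simp add: tree_coloring_def)
  then show ?thesis using cards forest_c by blast
qed

text \<open>At most three neighbours of \<open>a\<close> lie outside \<open>Q\<close>, so two of the
  colours 1, 2, 3 occur at most once among them. Exchanging between these two colours frees one for
  \<open>a\<close>.\<close>

lemma recolor_for_vertex:
  assumes X: "finite X" "a \<notin> X" and noloop: "\<And>x. {x} \<notin> E" and t: "3 \<le> t"
    and f: "tree_coloring E t X f"
    and indep: "\<And>v w. v \<in> nbs E X a \<Longrightarrow> w \<in> nbs E X a \<Longrightarrow> {v, w} \<notin> E"
    and few: "card {w \<in> nbs E X a. 2 \<le> card (nbs E X w)} \<le> 3"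
  shows "\<exists>h c. tree_coloring E t X h \<and> (\<forall>i. card (color_class X h i) = card (color_class X f i)) \<and>
    c \<in> {1..t} \<and> forest (insert a (color_class X h c)) E"
proof -
  define Q where "Q = {w \<in> nbs E X a. card (nbs E X w) \<le> 1}"
  define B where "B i = {w \<in> Q. f w = i \<and> nbs E (color_class X f i) w \<noteq> {}}" for i
  define P where "P i = nbs E (color_class X f i) a - Q" for i
  have finP: "finite (P i)" for i
    using X(1) by (simp add: P_def finite_nbs finite_color_class)
  have PP: "card (P i) \<le> 1 \<or> card (P j) \<le> 1" if "i \<noteq> j" for i j
  proof -
    have "card (P i) + card (P j) = card (P i \<union> P j)"
      using that finP by (intro card_Un_disjoint[symmetric]) (auto simp: P_def nbs_def color_class_def)
    also have "\<dots> \<le> card {w \<in> nbs E X a. 2 \<le> card (nbs E X w)}"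
      using X(1)
      by (intro card_mono) (auto simp: P_def Q_def nbs_def color_class_def)
    finally show ?thesis using few by linarith
  qed
  have "\<exists>c\<in>{1, 2, 3}. \<exists>d\<in>{1, 2, 3}. c \<noteq> d \<and> card (P c) \<le> 1 \<and> card (P d) \<le> 1"
    using PP[of 1 2] PP[of 1 3] PP[of 2 3] by auto
  then obtain c' d' where cd': "c' \<in> {1, 2, 3}" "d' \<in> {1, 2, 3}" "c' \<noteq> d'"
    "card (P c') \<le> 1" "card (P d') \<le> 1" by blast
  \<comment> \<open>Of the two candidates, \<open>c\<close> is the one with the smaller set
    \<open>B\<close>, so that the exchange finds enough partners in \<open>B d\<close>.\<close>
  define c where "c = (if card (B c') \<le> card (B d') then c' else d')"
  define d where "d = (if card (B c') \<le> card (B d') then d' else c')"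
  have cd: "c \<in> {1..t}" "d \<in> {1..t}" "c \<noteq> d" "card (P c) \<le> 1" "card (B c) \<le> card (B d)"
    using cd' t by (auto simp: c_def d_def)
  show ?thesis
    using swap_colors[OF X noloop f cd(1-3) indep Q_def cd(4)[unfolded P_def] B_def cd(5)] cd(1)
    by blast
qed

section \<open>Degeneracy, discharging and the induction for sparse graphs\<close>

lemma sum_card_nbs:
  assumes "simple_graph V E"
  shows "(\<Sum>v\<in>V. card (nbs E V v)) = 2 * card E"
proof -
  have fin: "finite V" "finite E"
    using assms simple_graph_finite_edges by (auto simp: simple_graph_def)
  have "(\<Sum>v\<in>V. card (nbs E V v)) = (\<Sum>v\<in>V. \<Sum>e\<in>{e \<in> E. v \<in> e}. 1)"
    using card_incident_edges[OF assms] by simp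
  also have "\<dots> = (\<Sum>e\<in>E. \<Sum>v\<in>{v \<in> V. v \<in> e}. 1)"
    by (rule sum.swap_restrict[OF fin])
  also have "\<dots> = (\<Sum>e\<in>E. 2)"
  proof (rule sum.cong)
    fix e assume "e \<in> E"
    then have "{v \<in> V. v \<in> e} = e" "card e = 2" using assms by (auto simp: simple_graph_def)
    then show "(\<Sum>v\<in>{v \<in> V. v \<in> e}. 1) = (2::nat)" by simp
  qed simp
  finally show ?thesis by simp
qed

text \<open>Sparsity is demanded of all nonempty \<open>W\<close> because the induction deletes
  vertices; in this form it passes to every induced subgraph.\<close>

locale sparse_graph =
  fixes V :: "'a set" and E :: "'a set set"
  assumes simple: "simple_graph V E"
    and no_triangle: "\<And>x y z. {x, y} \<in> E \<Longrightarrow> {y, z} \<in> E \<Longrightarrow> {x, z} \<notin> E"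
    and sparse: "\<And>W. W \<subseteq> V \<Longrightarrow> W \<noteq> {} \<Longrightarrow> 3 * card (induced_edges E W) < 5 * card W"
begin

lemma finV: "finite V"
  using simple by (simp add: simple_graph_def)

lemma no_loop: "{x} \<notin> E"
  by (rule simple_graph_no_loop[OF simple])

lemma sum_degree_less:
  assumes "W \<subseteq> V" "W \<noteq> {}"
  shows "3 * (\<Sum>v\<in>W. card (nbs E W v)) < 10 * card W"
proof -
  have "simple_graph W (induced_edges E W)"
    using simple finite_subset[OF assms(1) finV] by (auto simp: simple_graph_def induced_edges_def)
  moreover have "nbs (induced_edges E W) W v = nbs E W v" if "v \<in> W" for v
    using that by (auto simp: nbs_def induced_edges_def)
  ultimately have "(\<Sum>v\<in>W. card (nbs E W v)) = 2 * card (induced_edges E W)"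
    using sum_card_nbs[of W "induced_edges E W"] by simp
  then show ?thesis using sparse[OF assms] by simp
qed

text \<open>The average degree is below 10/3, hence below 4.\<close>

lemma degenerate:
  assumes "W \<subseteq> V" "W \<noteq> {}"
  shows "\<exists>v\<in>W. card (nbs E W v) \<le> 3"
proof (rule ccontr)
  assume "\<not> ?thesis"
  then have "(\<Sum>v\<in>W. 4) \<le> (\<Sum>v\<in>W. card (nbs E W v))"
    by (intro sum_mono) (auto simp: not_le)
  then show False using sum_degree_less[OF assms] by simp
qed

text \<open>The initial charges have negative sum, yet without a reducible configuration no final
  charge is negative. A vertex of degree 2 lacks 4 and gets 2 from each neighbour; one of degree 3
  lacks 1 and gets it from a neighbour of degree at least 5.\<close>

lemma reducible_configuration:
  assumes W: "W \<subseteq> V" "W \<noteq> {}"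
  obtains v where "v \<in> W" "card (nbs E W v) \<le> 1"
  | v y where "v \<in> W" "y \<in> nbs E W v" "card (nbs E W v) = 2"
      "card (nbs E W y) \<le> 6 \<or> card {w \<in> nbs E W y. card (nbs E W w) \<noteq> 2} \<le> 3"
  | v where "v \<in> W" "card (nbs E W v) = 3" "\<And>y. y \<in> nbs E W v \<Longrightarrow> card (nbs E W y) \<le> 4"
proof (rule ccontr)
  assume "\<not> thesis"
  note red = this that
  define d where "d v = card (nbs E W v)" for v
  have fin: "finite W" "finite (nbs E W v)" for v
    using finite_subset[OF W(1) finV] by (auto simp: finite_nbs)
  have d1: "2 \<le> d v" if "v \<in> W" for v
    using red(1) red(2)[OF that] by (fastforce simp: d_def)
  have d2: "7 \<le> d y" "4 \<le> card {w \<in> nbs E W y. d w \<noteq> 2}"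
    if "v \<in> W" "y \<in> nbs E W v" "d v = 2" for v y
    using red(1) red(3)[OF that(1,2)] that(3) unfolding d_def by fastforce+
  have d3: "\<exists>y\<in>nbs E W v. 5 \<le> d y" if "v \<in> W" "d v = 3" for v
    using red(1) red(4)[OF that(1)] that(2) unfolding d_def by fastforce
  \<comment> \<open>Discharging: \<open>v\<close> starts with \<open>3 d(v) - 10\<close> and sends \<open>g v w\<close> to its neighbour \<open>w\<close>.\<close>
  define g :: "'a \<Rightarrow> 'a \<Rightarrow> int" where
    "g y w = (if d y < 5 then 0 else if d w = 2 then 2 else if d w = 3 then 1 else 0)" for y w
  have g0: "0 \<le> g y w" for y w by (simp add: g_def)
  have nonneg: "0 \<le> 3 * int (d v) - 10 - (\<Sum>w\<in>nbs E W v. g v w) + (\<Sum>w\<in>nbs E W v. g w v)"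
    if v: "v \<in> W" for v
  proof -
    have inc: "0 \<le> (\<Sum>w\<in>nbs E W v. g w v)" by (simp add: sum_nonneg g0)
    have out: "(\<Sum>w\<in>nbs E W v. g v w) = 0" if "d v < 5" using that by (simp add: g_def)
    consider "d v = 2" | "d v = 3" | "d v = 4" | "5 \<le> d v" using d1[OF v] by linarith
    then show ?thesis
    proof cases
      case 1
      have "(\<Sum>w\<in>nbs E W v. g w v) = (\<Sum>w\<in>nbs E W v. 2)"
      proof (rule sum.cong)
        fix w assume "w \<in> nbs E W v"
        then show "g w v = 2" using d2(1)[OF v _ 1] 1 by (fastforce simp: g_def)
      qed simp
      then show ?thesis using 1 out by (simp add: d_def)
    next
      case 2
      obtain y where y: "y \<in> nbs E W v" "5 \<le> d y" using d3[OF v 2] by blast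
      have "g y v \<le> (\<Sum>w\<in>nbs E W v. g w v)"
        by (rule member_le_sum[OF y(1) _ fin(2)]) (simp add: g0)
      then show ?thesis using 2 y out by (simp add: g_def)
    next
      case 3
      then show ?thesis using inc out by simp
    next
      case 4
      \<comment> \<open>A vertex of degree d sends at most 1 to each neighbour and 1 more to those
        in \<open>K\<close>. If \<open>K\<close> is empty, 2d - 10 remains at least; otherwise d is
        at least 7 and \<open>K\<close> has at most d - 4 elements, which leaves at least d -
        6.\<close>
      define K where "K = {w \<in> nbs E W v. d w = 2}"
      have "(\<Sum>w\<in>nbs E W v. g v w) \<le> (\<Sum>w\<in>nbs E W v. 1 + (if d w = 2 then 1 else 0))"
        by (intro sum_mono) (simp add: g_def)
      also have "\<dots> = int (d v) + int (card K)"
        unfolding sum.distrib K_def using fin(2)[of v] by (simp add: d_def sum.inter_filter[symmetric])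
      finally have le: "(\<Sum>w\<in>nbs E W v. g v w) \<le> int (d v) + int (card K)" .
      show ?thesis
      proof (cases "K = {}")
        case True
        then show ?thesis using le inc 4 by simp
      next
        case False
        then obtain w where w: "w \<in> nbs E W v" "d w = 2" by (auto simp: K_def)
        then have "w \<in> W" "v \<in> nbs E W w" using v by (auto simp: nbs_def insert_commute)
        then have ge: "7 \<le> d v" "4 \<le> card {w \<in> nbs E W v. d w \<noteq> 2}" using d2 w(2) by auto
        have "d v = card (K \<union> {w \<in> nbs E W v. d w \<noteq> 2})"
          unfolding d_def K_def by (rule arg_cong[where f = card]) auto
        also have "\<dots> = card K + card {w \<in> nbs E W v. d w \<noteq> 2}"
          using fin(2)[of v] by (intro card_Un_disjoint) (auto simp: K_def)
        finally show ?thesis using le inc ge by linarith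
      qed
    qed
  qed
  have swap: "(\<Sum>v\<in>W. \<Sum>w\<in>nbs E W v. g v w) = (\<Sum>v\<in>W. \<Sum>w\<in>nbs E W v. g w v)"
    using sum.swap_restrict[OF fin(1) fin(1), of g "\<lambda>v w. {v, w} \<in> E"]
    by (simp add: nbs_def insert_commute)
  have "0 \<le> (\<Sum>v\<in>W. 3 * int (d v) - 10 - (\<Sum>w\<in>nbs E W v. g v w) + (\<Sum>w\<in>nbs E W v. g w v))"
    by (intro sum_nonneg nonneg)
  also have "\<dots> = 3 * int (\<Sum>v\<in>W. d v) - 10 * int (card W)"
    using swap by (simp add: sum.distrib sum_subtractf sum_distrib_left)
  finally show False using sum_degree_less[OF W] unfolding d_def by linarith
qed

text \<open>Repeatedly move a vertex of degree at most 3 in the remaining graph into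
  \<open>S\<close>. Later moves can only lower the number of neighbours outside \<open>S\<close> of
  the earlier ones.\<close>

lemma degenerate_extension:
  assumes "W \<subseteq> V" "S0 \<subseteq> W" "card S0 \<le> t" "t \<le> card W"
  shows "\<exists>S. S0 \<subseteq> S \<and> S \<subseteq> W \<and> card S = t \<and> (\<forall>m\<in>S - S0. card (nbs E (W - S) m) \<le> 3)"
  using assms(3,4)
proof (induction t rule: dec_induct)
  case base
  show ?case using assms(2) by (intro exI[of _ S0]) simp
next
  case (step n)
  then obtain S where S: "S0 \<subseteq> S" "S \<subseteq> W" "card S = n"
    "\<forall>m\<in>S - S0. card (nbs E (W - S) m) \<le> 3" by auto
  have fin: "finite W" using finite_subset[OF assms(1) finV] .
  have "W - S \<noteq> {}" using S step.prems by auto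
  then obtain v where v: "v \<in> W - S" "card (nbs E (W - S) v) \<le> 3"
    using degenerate[of "W - S"] assms(1) by blast
  have "card (nbs E (W - insert v S) m) \<le> card (nbs E (W - S) m)" for m
    using fin by (intro card_mono finite_nbs nbs_mono) auto
  then have "\<forall>m\<in>insert v S - S0. card (nbs E (W - insert v S) m) \<le> 3"
    using S(4) v(2) order_trans by blast
  then show ?case
    using S v fin finite_subset[OF S(2) fin] by (intro exI[of _ "insert v S"]) auto
qed

text \<open>The set \<open>S\<close> depends only on the graph. The given colouring of the rest may
  be recoloured before it is extended, but with all class sizes kept.\<close>

lemma equitable_step:
  assumes t: "3 \<le> t" and W: "W \<subseteq> V" "t \<le> card W"
  shows "\<exists>S. S \<subseteq> W \<and> card S = t \<and> (\<forall>f. tree_coloring E t (W - S) f \<longrightarrow>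
    (\<exists>h. tree_coloring E t W h \<and>
      (\<forall>i\<in>{1..t}. card (color_class W h i) = Suc (card (color_class (W - S) f i)))))"
proof -
  have fin: "finite W" using finite_subset[OF W(1) finV] .
  have W0: "W \<noteq> {}" using t W(2) by auto
  have le: "card (nbs E (W - S) x) \<le> card (nbs E W x - Z)" if "Z \<subseteq> S" for S x Z
    using that fin by (intro card_mono) (auto simp: nbs_def)
  have le0: "card (nbs E (W - S) x) \<le> card (nbs E W x)" for S x
    using le[of "{}" S x] by simp
  \<comment> \<open>Common end of all cases: \<open>a\<close> is coloured first, possibly after
    recolouring, and \<open>v\<close> last.\<close>
  have finish: ?thesis
    if S: "S \<subseteq> W" "card S = t" "a \<in> S" "v \<in> S" "a \<noteq> v" "card (nbs E (W - S) v) \<le> 1"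
      and rest: "\<And>m. m \<in> S - {a, v} \<Longrightarrow> card (nbs E (W - S) m) \<le> 3"
      and first: "\<And>f. tree_coloring E t (W - S) f \<Longrightarrow> \<exists>h c. tree_coloring E t (W - S) h \<and>
        (\<forall>i. card (color_class (W - S) h i) = card (color_class (W - S) f i)) \<and>
        c \<in> {1..t} \<and> forest (insert a (color_class (W - S) h c)) E" for S a v
  proof (intro exI[of _ S] conjI allI impI)
    fix f assume "tree_coloring E t (W - S) f"
    then obtain h c where h: "tree_coloring E t (W - S) h"
      "\<forall>i. card (color_class (W - S) h i) = card (color_class (W - S) f i)"
      "c \<in> {1..t}" "forest (insert a (color_class (W - S) h c)) E"
      using first by blast
    have "W - S \<union> S = W" "S \<inter> (W - S) = {}" "finite S" "finite (W - S)"
      using S(1) fin finite_subset by auto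
    then show "\<exists>h. tree_coloring E t W h \<and>
        (\<forall>i\<in>{1..t}. card (color_class W h i) = Suc (card (color_class (W - S) f i)))"
      using extend_tree_coloring[of "W - S" S t a v E h c] S h rest no_loop by simp
  qed (use S in auto)
  have finish5: ?thesis
    if S: "S \<subseteq> W" "card S = t" "a \<in> S" "v \<in> S" "a \<noteq> v" "card (nbs E (W - S) v) \<le> 1"
      and rest: "\<And>m. m \<in> S - {a, v} \<Longrightarrow> card (nbs E (W - S) m) \<le> 3"
      and a: "card (nbs E (W - S) a) \<le> 5" for S a v
    using free_color[of "W - S" t E _ a] fin t no_loop a
    by (intro finish[OF S rest]) blast+
  from W(1) W0 show ?thesis
  proof (cases rule: reducible_configuration)
    case (1 v)
    obtain S where S: "{v} \<subseteq> S" "S \<subseteq> W" "card S = t"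
      "\<forall>m\<in>S - {v}. card (nbs E (W - S) m) \<le> 3"
      using degenerate_extension[OF W(1), of "{v}" t] 1 t W(2) by auto
    have "\<not> S \<subseteq> {v}" using S(3) t card_mono[of "{v}" S] by auto
    then obtain a where a: "a \<in> S" "a \<noteq> v" by blast
    have "card (nbs E (W - S) a) \<le> 3" using S(4) a by blast
    then have "card (nbs E (W - S) a) \<le> 5" by simp
    moreover have "card (nbs E (W - S) v) \<le> 1" using le0[of S v] 1 by linarith
    ultimately show ?thesis using S a by (intro finish5[of S a v]) auto
  next
    case (2 v y)
    have vy: "y \<in> W" "y \<noteq> v" using 2 no_loop by (auto simp: nbs_def)
    obtain S where S: "{v, y} \<subseteq> S" "S \<subseteq> W" "card S = t"
      "\<forall>m\<in>S - {v, y}. card (nbs E (W - S) m) \<le> 3"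
      using degenerate_extension[OF W(1), of "{v, y}" t] 2 vy t W(2) by auto
    \<comment> \<open>One of the two neighbours of \<open>v\<close> is \<open>y\<close>, which is in
      \<open>S\<close>, so at most one is outside. The vertex to be coloured first is
      \<open>y\<close>.\<close>
    have v: "card (nbs E (W - S) v) \<le> 1"
      using le[of "{y}" S v] S(1) 2 fin by (simp add: finite_nbs card_Diff_subset)
    have rest: "card (nbs E (W - S) m) \<le> 3" if "m \<in> S - {y, v}" for m
      using S(4) that by blast
    from 2(4) show ?thesis
    proof
      assume "card (nbs E W y) \<le> 6"
      moreover have "v \<in> nbs E W y" using 2 by (auto simp: nbs_def insert_commute)
      ultimately have "card (nbs E (W - S) y) \<le> 5"
        using le[of "{v}" S y] S(1) fin by (simp add: finite_nbs card_Diff_subset)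
      then show ?thesis using S vy v rest by (intro finish5[of S y v]) auto
    next
      assume few: "card {w \<in> nbs E W y. card (nbs E W w) \<noteq> 2} \<le> 3"
      \<comment> \<open>A neighbour of \<open>y\<close> of degree 2 loses \<open>y\<close> to
        \<open>S\<close> and keeps at most one neighbour outside; it is available for the exchange
        of colours.\<close>
      have "{w \<in> nbs E (W - S) y. 2 \<le> card (nbs E (W - S) w)}
          \<subseteq> {w \<in> nbs E W y. card (nbs E W w) \<noteq> 2}"
      proof (intro subsetI CollectI conjI notI; elim CollectE conjE)
        fix w assume w: "w \<in> nbs E (W - S) y" "2 \<le> card (nbs E (W - S) w)"
        show "w \<in> nbs E W y" using w(1) by (auto simp: nbs_def)
        assume "card (nbs E W w) = 2"
        moreover have "y \<in> nbs E W w" using w(1) vy by (auto simp: nbs_def insert_commute)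
        ultimately have "card (nbs E (W - S) w) \<le> 1"
          using le[of "{y}" S w] S(1) fin by (simp add: finite_nbs card_Diff_subset)
        then show False using w(2) by simp
      qed
      then have "card {w \<in> nbs E (W - S) y. 2 \<le> card (nbs E (W - S) w)}
          \<le> card {w \<in> nbs E W y. card (nbs E W w) \<noteq> 2}"
        using finite_nbs[OF fin] by (intro card_mono) auto
      then have few': "card {w \<in> nbs E (W - S) y. 2 \<le> card (nbs E (W - S) w)} \<le> 3"
        using few by linarith
      have indep: "{x, w} \<notin> E" if "x \<in> nbs E (W - S) y" "w \<in> nbs E (W - S) y" for x w
        using that no_triangle[of x y w] by (auto simp: nbs_def insert_commute)
      show ?thesis
        using S vy v rest fin no_loop
        by (intro finish[of S y v] recolor_for_vertex[OF _ _ _ t _ indep few']) auto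
    qed
  next
    case (3 v)
    obtain a b where ab: "a \<in> nbs E W v" "b \<in> nbs E W v" "a \<noteq> b"
    proof -
      obtain D where "D \<subseteq> nbs E W v" "card D = 2"
        using 3(2) obtain_subset_with_card_n[of 2 "nbs E W v"] by auto
      then show ?thesis using that by (auto simp: card_2_iff)
    qed
    have abv: "a \<in> W" "b \<in> W" "a \<noteq> v" "b \<noteq> v" using ab no_loop by (auto simp: nbs_def)
    obtain S where S: "{v, a, b} \<subseteq> S" "S \<subseteq> W" "card S = t"
      "\<forall>m\<in>S - {v, a, b}. card (nbs E (W - S) m) \<le> 3"
      using degenerate_extension[OF W(1), of "{v, a, b}" t] 3 ab abv t W(2) by auto
    \<comment> \<open>With two of its three neighbours in \<open>S\<close>, \<open>v\<close> can
      come last. Every neighbour of \<open>v\<close> has degree at most 4 and loses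
      \<open>v\<close>, so \<open>a\<close> and \<open>b\<close> have at most three neighbours
      outside \<open>S\<close>.\<close>
    have "card (nbs E W v - {a, b}) = 1"
      using ab 3(2) fin by (simp add: card_Diff_subset finite_nbs)
    then have v: "card (nbs E (W - S) v) \<le> 1" using le[of "{a, b}" S v] S(1) by simp
    have nb: "card (nbs E (W - S) y) \<le> 3" if "y \<in> nbs E W v" for y
    proof -
      have "v \<in> nbs E W y" using that 3(1) by (auto simp: nbs_def insert_commute)
      then show ?thesis
        using le[of "{v}" S y] 3(3)[OF that] S(1) fin by (simp add: finite_nbs card_Diff_subset)
    qed
    have "card (nbs E (W - S) m) \<le> 3" if "m \<in> S - {a, v}" for m
      using S(4) nb[OF ab(2)] that by (cases "m = b") auto
    moreover have "card (nbs E (W - S) a) \<le> 5" using nb[OF ab(1)] by simp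
    ultimately show ?thesis using S abv v by (intro finish5[of S a v]) auto
  qed
qed

text \<open>Strong induction, removing \<open>t\<close> vertices at a time; once fewer than
  \<open>t\<close> are left, they receive distinct colours.\<close>

theorem equitable_tree_coloring_exists:
  assumes "3 \<le> t" "W \<subseteq> V"
  shows "\<exists>f. equitable_tree_coloring W E t f"
  using assms(2)
proof (induction "card W" arbitrary: W rule: less_induct)
  case less
  have fin: "finite W" using finite_subset[OF less.prems finV] .
  show ?case
  proof (cases "t \<le> card W")
    case True
    obtain S where S: "S \<subseteq> W" "card S = t"
      and ext: "\<And>f. tree_coloring E t (W - S) f \<Longrightarrow> \<exists>h. tree_coloring E t W h \<and>
        (\<forall>i\<in>{1..t}. card (color_class W h i) = Suc (card (color_class (W - S) f i)))"
      using equitable_step[OF assms(1) less.prems True] by blast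
    have "card (W - S) < card W"
      using S True assms(1) fin by (simp add: card_Diff_subset finite_subset)
    then obtain f where f: "equitable_tree_coloring (W - S) E t f"
      using less by blast
    then have "tree_coloring E t (W - S) f"
      by (simp add: equitable_tree_coloring_def equitable_coloring_def tree_coloring_def forest_induced)
    then obtain h where "tree_coloring E t W h"
      "\<forall>i\<in>{1..t}. card (color_class W h i) = Suc (card (color_class (W - S) f i))"
      using ext by blast
    then have "equitable_tree_coloring W E t h"
      using f
      by (simp add: equitable_tree_coloring_def equitable_coloring_def tree_coloring_def forest_induced)
    then show ?thesis by blast
  next
    case False
    then have "card W \<le> card {1..t}" by simp
    then obtain f where f: "f ` W \<subseteq> {1..t}" "inj_on f W"
      using card_le_inj[OF fin, of "{1..t}"] by auto
    have le1: "card (color_class W f i) \<le> 1" for i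
      unfolding color_class_def using f(2) fin by (auto simp: card_le_Suc0_iff_eq inj_on_def)
    have "forest (color_class W f i) E" for i
    proof (cases "color_class W f i = {}")
      case False
      then obtain x where "color_class W f i = {x}"
        using le1[of i] finite_color_class[OF fin] by (metis One_nat_def card_1_singletonE card_0_eq le_Suc_eq le_zero_eq)
      then show ?thesis
        using forest_insert[OF forest_empty, of x E] no_loop by (simp add: nbs_def)
    qed (simp add: forest_empty)
    moreover have "\<bar>int (card (color_class W f i)) - int (card (color_class W f j))\<bar> \<le> 1" for i j
      using le1[of i] le1[of j] by linarith
    ultimately have "equitable_tree_coloring W E t f"
      using f(1)
      by (auto simp: equitable_tree_coloring_def equitable_coloring_def coloring_def forest_induced)
    then show ?thesis by blast
  qed
qed

end

section \<open>The number of edges of a plane graph\<close>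

locale plane_graph =
  fixes V :: "'a set" and E :: "'a set set" and p :: "'a \<Rightarrow> complex"
    and \<gamma> :: "'a set \<Rightarrow> real \<Rightarrow> complex"
  assumes simple: "simple_graph V E" and drawing: "plane_drawing V E p \<gamma>"
begin

text \<open>Isolated vertices contribute no points, so the faces depend on the edge set
  alone.\<close>

definition support :: "'a set set \<Rightarrow> complex set" where
  "support A = (\<Union>e\<in>A. path_image (\<gamma> e))"

definition open_edge :: "'a set \<Rightarrow> complex set" where
  "open_edge e = path_image (\<gamma> e) - p ` e"

definition faces :: "'a set set \<Rightarrow> complex set set" where
  "faces A = components (- support A)"

text \<open>The ends of the edge are excluded: a face that reaches \<open>e\<close> only at a vertex
  is not counted as bordering it.\<close>

definition touches :: "complex set \<Rightarrow> 'a set \<Rightarrow> bool" where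
  "touches F e \<longleftrightarrow> closure F \<inter> open_edge e \<noteq> {}"

section \<open>Drawn edges, closed curves and separation of points\<close>

lemma arc_edge: "e \<in> E \<Longrightarrow> arc (\<gamma> e)"
  and edge_ends: "e \<in> E \<Longrightarrow> {pathstart (\<gamma> e), pathfinish (\<gamma> e)} = p ` e"
  and edge_Int: "e \<in> E \<Longrightarrow> e' \<in> E \<Longrightarrow> e \<noteq> e' \<Longrightarrow>
    path_image (\<gamma> e) \<inter> path_image (\<gamma> e') = p ` (e \<inter> e')"
  and edge_vertices: "e \<in> E \<Longrightarrow> path_image (\<gamma> e) \<inter> p ` V = p ` e"
  using drawing by (simp_all add: plane_drawing_def)

lemma ends_subset: "e \<in> E \<Longrightarrow> p ` e \<subseteq> path_image (\<gamma> e)"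
  using edge_ends by (metis insert_subset empty_subsetI pathstart_in_path_image pathfinish_in_path_image)

lemma finite_edges: "finite E"
  using simple_graph_finite_edges[OF simple] .

lemma support_insert: "support (insert e A) = path_image (\<gamma> e) \<union> support A"
  by (simp add: support_def)

lemma support_Un: "support (A \<union> B) = support A \<union> support B"
  by (simp add: support_def)

lemma support_mono: "A \<subseteq> B \<Longrightarrow> support A \<subseteq> support B"
  unfolding support_def by blast

lemma compact_support: "A \<subseteq> E \<Longrightarrow> compact (support A)"
  unfolding support_def
  using finite_subset[OF _ finite_edges] arc_edge by (intro compact_UN compact_arc_image) auto

lemma open_compl_support: "A \<subseteq> E \<Longrightarrow> open (- support A)"
  using compact_support compact_imp_closed open_Compl by blast

lemma edge_Int_support:
  assumes "A \<subseteq> E" "e \<in> E" "e \<notin> A"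
  shows "path_image (\<gamma> e) \<inter> support A \<subseteq> p ` (e \<inter> \<Union>A)"
proof
  fix x assume "x \<in> path_image (\<gamma> e) \<inter> support A"
  then obtain e' where e': "e' \<in> A" "x \<in> path_image (\<gamma> e) \<inter> path_image (\<gamma> e')"
    by (auto simp: support_def)
  then have "x \<in> p ` (e \<inter> e')" using edge_Int[of e e'] assms by auto
  then show "x \<in> p ` (e \<inter> \<Union>A)" using e'(1) by blast
qed

lemma open_edge_disjoint:
  assumes "A \<subseteq> E" "e \<in> E" "e \<notin> A"
  shows "open_edge e \<inter> support A = {}"
  using edge_Int_support[OF assms] by (auto simp: open_edge_def)

lemma connected_open_edge: "e \<in> E \<Longrightarrow> connected (open_edge e)"
  unfolding open_edge_def
  using connected_simple_path_endless[OF arc_imp_simple_path[OF arc_edge]] edge_ends by metis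

lemma open_edge_nonempty: "e \<in> E \<Longrightarrow> open_edge e \<noteq> {}"
  unfolding open_edge_def
  using nonempty_simple_path_endless[OF arc_imp_simple_path[OF arc_edge]] edge_ends by metis

text \<open>An edge is an unordered pair, so its arc may have to be reversed before arcs are
  concatenated.\<close>

lemma oriented_edge:
  assumes "{x, y} \<in> E"
  obtains k where "arc k" "pathstart k = p x" "pathfinish k = p y"
    "path_image k = path_image (\<gamma> {x, y})"
proof -
  have "{pathstart (\<gamma> {x, y}), pathfinish (\<gamma> {x, y})} = {p x, p y}"
    using edge_ends[OF assms] by simp
  then consider "pathstart (\<gamma> {x, y}) = p x" "pathfinish (\<gamma> {x, y}) = p y"
    | "pathstart (\<gamma> {x, y}) = p y" "pathfinish (\<gamma> {x, y}) = p x"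
    by (auto simp: doubleton_eq_iff)
  then show thesis
  proof cases
    case 1
    then show ?thesis using that[of "\<gamma> {x, y}"] arc_edge[OF assms] by simp
  next
    case 2
    then show ?thesis
      using that[of "reversepath (\<gamma> {x, y})"] arc_edge[OF assms] by (simp add: arc_reversepath)
  qed
qed

text \<open>Confining the arc to edges within \<open>set xs\<close> drives the induction: the arc of
  the tail uses no edge at \<open>x\<close>, so the edge from \<open>x\<close> to \<open>y\<close>
  meets it only in \<open>p y\<close>.\<close>

lemma path_arc:
  assumes "A \<subseteq> E" "distinct xs" "2 \<le> length xs" "successively (\<lambda>x y. {x, y} \<in> A) xs"
  shows "\<exists>g. arc g \<and> pathstart g = p (hd xs) \<and> pathfinish g = p (last xs) \<and>
    path_image g \<subseteq> support {e \<in> A. e \<subseteq> set xs}"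
  using assms(2-4)
proof (induction xs rule: induct_list012)
  case (3 x y ys)
  have xy: "{x, y} \<in> A" "{x, y} \<in> E" using 3 assms(1) by auto
  obtain k where k: "arc k" "pathstart k = p x" "pathfinish k = p y"
    "path_image k = path_image (\<gamma> {x, y})"
    using oriented_edge[OF xy(2)] by blast
  have ksub: "path_image k \<subseteq> support {e \<in> A. e \<subseteq> set (x # y # ys)}"
    unfolding k(4) support_def using xy(1) by auto
  show ?case
  proof (cases ys)
    case Nil
    then show ?thesis using k ksub by (intro exI[of _ k]) auto
  next
    case (Cons z zs)
    then obtain g where g: "arc g" "pathstart g = p y" "pathfinish g = p (last (y # ys))"
      "path_image g \<subseteq> support {e \<in> A. e \<subseteq> set (y # ys)}"
      using "3.IH"(2) "3.prems" by auto
    have "{e \<in> A. e \<subseteq> set (y # ys)} \<subseteq> E" "{x, y} \<notin> {e \<in> A. e \<subseteq> set (y # ys)}"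
      using assms(1) "3.prems"(1) by auto
    then have "path_image k \<inter> path_image g \<subseteq> p ` ({x, y} \<inter> \<Union>{e \<in> A. e \<subseteq> set (y # ys)})"
      using edge_Int_support[of "{e \<in> A. e \<subseteq> set (y # ys)}" "{x, y}"] g(4) k(4) xy(2) by blast
    also have "\<dots> \<subseteq> p ` {y}" using "3.prems"(1) by (intro image_mono) auto
    finally have "arc (k +++ g)" using k g by (intro arc_join) auto
    moreover have "path_image g \<subseteq> support {e \<in> A. e \<subseteq> set (x # y # ys)}"
      by (rule order_trans[OF g(4) support_mono]) auto
    ultimately show ?thesis
      using k g ksub by (intro exI[of _ "k +++ g"]) (auto simp: path_image_join)
  qed
qed auto

text \<open>A path joining \<open>u\<close> and \<open>v\<close> in \<open>A\<close> is drawn as an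
  arc with image \<open>P\<close>, and the edge closes it to a Jordan curve. \<open>P\<close> is
  kept separate because it will be the intersection of the curve with
  \<open>support A\<close>.\<close>

lemma closed_curve_through_edge:
  assumes A: "A \<subseteq> E" and e: "{u, v} \<in> E" "{u, v} \<notin> A" and joined: "(u, v) \<in> joined A"
  obtains c P where "simple_path c" "pathfinish c = pathstart c"
    "path_image c = P \<union> path_image (\<gamma> {u, v})" "P \<subseteq> support A" "connected P" "p ` {u, v} \<subseteq> P"
proof -
  have uv: "u \<noteq> v" using simple_graph_no_loop[OF simple] e(1) by auto
  obtain xs where xs: "xs \<noteq> []" "hd xs = u" "last xs = v" "distinct xs"
    "successively (\<lambda>x y. {x, y} \<in> A) xs"
    using joined_distinct_path[OF joined] by blast
  have "2 \<le> length xs" using xs(1-3) uv by (cases xs; cases "tl xs") auto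
  then obtain g where g: "arc g" "pathstart g = p u" "pathfinish g = p v"
    "path_image g \<subseteq> support {e \<in> A. e \<subseteq> set xs}"
    using path_arc[OF A xs(4) _ xs(5)] xs(2,3) by auto
  obtain k where k: "arc k" "pathstart k = p v" "pathfinish k = p u"
    "path_image k = path_image (\<gamma> {u, v})"
    using oriented_edge[of v u] e(1) by (auto simp: insert_commute)
  have gA: "path_image g \<subseteq> support A" by (rule order_trans[OF g(4) support_mono]) auto
  then have "path_image g \<inter> path_image k \<subseteq> {p u, p v}"
    using edge_Int_support[OF A e] k(4) by auto
  then have "simple_path (g +++ k)" using g k by (intro simple_path_join_loop) auto
  moreover have "p ` {u, v} \<subseteq> path_image g"
    using g(2,3) pathstart_in_path_image[of g] pathfinish_in_path_image[of g] by auto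
  ultimately show thesis
    using that[of "g +++ k" "path_image g"] g k gA connected_arc_image[OF g(1)]
    by (simp add: path_image_join)
qed

text \<open>Janiszewski's theorem for the curve and \<open>support A\<close>: their intersection is
  the connected set \<open>P\<close>, their union is \<open>support (insert e A)\<close>.\<close>

lemma connected_component_edge_in_cycle:
  assumes "A \<subseteq> E" "e \<in> E" and P: "P \<subseteq> support A" "connected P" "p ` e \<subseteq> P" and "e \<notin> A"
    and c: "path c" "path_image c = P \<union> path_image (\<gamma> e)"
    and ab: "connected_component (- support A) a b" "connected_component (- path_image c) a b"
  shows "connected_component (- support (insert e A)) a b"
proof -
  have "path_image (\<gamma> e) \<inter> support A \<subseteq> P"
    using edge_Int_support[OF assms(1,2,6)] P(3) by blast
  then have "path_image c \<inter> support A = P" using c(2) P(1) by blast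
  then have "connected_component (- (path_image c \<union> support A)) a b"
    using Janiszewski[OF compact_path_image[OF c(1)] compact_imp_closed[OF compact_support[OF assms(1)]]] P(2) ab
    by simp
  moreover have "path_image c \<union> support A = support (insert e A)"
    using c(2) P(1) by (auto simp: support_insert)
  ultimately show ?thesis by simp
qed

lemma connected_component_bridge:
  assumes A: "A \<subseteq> E" and e: "{u, v} \<in> E" "{u, v} \<notin> A" and sep: "(u, v) \<notin> joined A"
    and ab: "connected_component (- support A) a b"
      "a \<notin> path_image (\<gamma> {u, v})" "b \<notin> path_image (\<gamma> {u, v})"
  shows "connected_component (- support (insert {u, v} A)) a b"
proof -
  \<comment> \<open>The edges of the component of \<open>u\<close>, and the others: the edge \<open>{u, v}\<close> meets each part in at
    most one point, so Janiszewski's theorem applies twice.\<close>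
  define K where "K = {e \<in> A. \<exists>x\<in>e. (u, x) \<in> joined A}"
  define L where "L = A - K"
  have K: "(u, x) \<in> joined A" if eK: "e \<in> K" "x \<in> e" for e x
  proof -
    obtain y where y: "e \<in> A" "y \<in> e" "(u, y) \<in> joined A" using eK by (auto simp: K_def)
    have "card e = 2" using y(1) A simple by (auto simp: simple_graph_def)
    then have "x = y \<or> {y, x} \<in> A" using y eK(2) by (auto simp: card_2_iff insert_commute)
    then show ?thesis using y(3) by (auto intro: rtrancl_into_rtrancl)
  qed
  have KL: "K \<subseteq> E" "L \<subseteq> E" "{u, v} \<notin> K" "{u, v} \<notin> L" "A = K \<union> L"
    using A e by (auto simp: K_def L_def)
  have "v \<notin> \<Union>K" using K sep by blast
  then have "path_image (\<gamma> {u, v}) \<inter> support K \<subseteq> {p u}"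
    using edge_Int_support[OF KL(1) e(1) KL(3)] by auto
  then have conK: "connected (path_image (\<gamma> {u, v}) \<inter> support K)"
    by (metis connected_empty connected_sing subset_singletonD)
  have "u \<notin> \<Union>L" by (auto simp: L_def K_def)
  then have eL: "path_image (\<gamma> {u, v}) \<inter> support L \<subseteq> {p v}"
    using edge_Int_support[OF KL(2) e(1) KL(4)] by auto
  have "support K \<inter> support L = {}"
  proof (rule ccontr)
    assume "support K \<inter> support L \<noteq> {}"
    then obtain x e1 e2 where x: "e1 \<in> K" "e2 \<in> L" "x \<in> path_image (\<gamma> e1) \<inter> path_image (\<gamma> e2)"
      by (auto simp: support_def)
    moreover have "e1 \<noteq> e2" using x by (auto simp: L_def)
    ultimately have "x \<in> p ` (e1 \<inter> e2)" using edge_Int[of e1 e2] KL(1,2) by auto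
    then show False using K[OF x(1)] x(2) by (auto simp: L_def K_def)
  qed
  then have "(path_image (\<gamma> {u, v}) \<union> support K) \<inter> support L \<subseteq> {p v}" using eL by blast
  then have conL: "connected ((path_image (\<gamma> {u, v}) \<union> support K) \<inter> support L)"
    by (metis connected_empty connected_sing subset_singletonD)
  have cKL: "connected_component (- support K) a b" "connected_component (- support L) a b"
    using ab(1) connected_component_mono[of "- support A"] KL(5) by (auto simp: support_Un)
  \<comment> \<open>An arc alone does not separate the plane; the supports of \<open>K\<close> and
    then of \<open>L\<close> are added to it.\<close>
  have "connected_component (- path_image (\<gamma> {u, v})) a b"
    using connected_arc_complement[OF arc_edge[OF e(1)]] ab(2,3)
    by (simp add: connected_iff_connected_component)
  then have "connected_component (- (path_image (\<gamma> {u, v}) \<union> support K)) a b"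
    using cKL(1) compact_support[OF KL(1)] arc_edge[OF e(1)] conK
    by - (rule Janiszewski; auto simp: compact_Un compact_arc_image compact_imp_closed)
  then have "connected_component (- ((path_image (\<gamma> {u, v}) \<union> support K) \<union> support L)) a b"
    using cKL(2) compact_support[OF KL(1)] compact_support[OF KL(2)] arc_edge[OF e(1)] conL
    by - (rule Janiszewski; auto simp: compact_Un compact_arc_image compact_imp_closed)
  then show ?thesis by (simp add: support_insert KL(5) support_Un Un_assoc)
qed

lemma edge_cases:
  assumes "e \<in> E"
  obtains u v where "e = {u, v}" "u \<noteq> v"
  using assms simple by (auto simp: simple_graph_def card_2_iff)

text \<open>Edges are added one by one. The ends of a new edge are not joined before, since that
  would create a cycle, so the edge separates no points.\<close>

lemma connected_forest_complement:
  assumes "A \<subseteq> E" "forest V A"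
  shows "connected (- support A)"
  using finite_subset[OF assms(1) finite_edges] assms
proof (induction A rule: finite_induct)
  case empty
  then show ?case by (simp add: support_def connected_UNIV)
next
  case (insert e A)
  have IH: "connected (- support A)"
    using insert forest_subset[of V "insert e A" V A] by auto
  obtain u v where uv: "e = {u, v}" using edge_cases insert.prems by (metis insert_subset)
  have "simple_graph V (insert {u, v} A)"
    using simple_graph_subset[OF simple] insert.prems(1) uv by blast
  then have "(u, v) \<notin> joined A"
    using graph_cycle_if_joined[of V u v A] insert.prems(2) insert.hyps(2) uv by (auto simp: forest_def)
  then have "connected_component (- support (insert e A)) a b"
    if "a \<notin> support (insert e A)" "b \<notin> support (insert e A)" for a b
    unfolding uv using that IH insert uv
    by (intro connected_component_bridge)
      (auto simp: support_insert connected_iff_connected_component)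
  then show ?case by (simp add: connected_iff_connected_component)
qed

section \<open>Faces and the edges bordering them\<close>

lemma face_props:
  assumes "A \<subseteq> E" "F \<in> faces A"
  shows "open F" "connected F" "F \<noteq> {}" "F \<inter> support A = {}" "frontier F \<subseteq> support A"
proof -
  have F: "F \<in> components (- support A)" using assms by (simp add: faces_def)
  show "open F" using open_components[OF open_compl_support[OF assms(1)] F] .
  show "connected F" "F \<noteq> {}" using F in_components_connected in_components_nonempty by auto
  show "F \<inter> support A = {}" using in_components_subset[OF F] by blast
  show "frontier F \<subseteq> support A"
    using frontier_of_components_closed_complement[OF compact_imp_closed[OF compact_support[OF assms(1)]] F] .
qed

lemma face_eq_component:
  assumes "F \<in> faces A" "a \<in> F"
  shows "F = connected_component_set (- support A) a"
proof -
  obtain x where "F = connected_component_set (- support A) x"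
    using assms(1) unfolding faces_def components_def by blast
  then show ?thesis using connected_component_eq[of a "- support A" x] assms(2) by simp
qed

lemma face_eq:
  assumes "F \<in> faces A" "G \<in> faces A" "a \<in> F" "b \<in> G" "connected_component (- support A) a b"
  shows "F = G"
  using face_eq_component[OF assms(1,3)] face_eq_component[OF assms(2,4)]
    connected_component_eq[of b "- support A" a] assms(5) by simp

text \<open>Once \<open>e\<close> is deleted, its open edge becomes a connected bridge between the
  faces that touch it.\<close>

lemma touching_faces_connected:
  assumes A: "A \<subseteq> E" "e \<in> E" "e \<notin> A"
    and F: "F \<in> faces (insert e A)" "touches F e" "a \<in> F"
    and G: "G \<in> faces (insert e A)" "touches G e" "b \<in> G"
  shows "connected_component (- support A) a b"
proof -
  have E: "insert e A \<subseteq> E" using A by simp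
  have step: "\<exists>x\<in>open_edge e. connected_component (- support A) a x"
    if F: "F \<in> faces (insert e A)" "touches F e" "a \<in> F" for F a
  proof -
    obtain x where x: "x \<in> closure F" "x \<in> open_edge e" using F(2) by (auto simp: touches_def)
    have "connected (insert x F)"
      using x(1) closure_subset[of F]
      by (intro connected_intermediate_closure[OF face_props(2)[OF E F(1)]]) auto
    moreover have "insert x F \<subseteq> - support A"
      using face_props(4)[OF E F(1)] x(2) open_edge_disjoint[OF A] by (auto simp: support_insert)
    ultimately have "connected_component (- support A) a x"
      using F(3) unfolding connected_component_def by blast
    then show ?thesis using x(2) by blast
  qed
  obtain x where x: "x \<in> open_edge e" "connected_component (- support A) a x" using step[OF F] by blast
  obtain y where y: "y \<in> open_edge e" "connected_component (- support A) b y" using step[OF G] by blast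
  have "connected_component (- support A) x y"
    unfolding connected_component_def
    using connected_open_edge[OF A(2)] open_edge_disjoint[OF A] x(1) y(1) by blast
  then show ?thesis
    using x(2) y(2) by (meson connected_component_sym connected_component_trans)
qed

text \<open>Without \<open>e\<close> all faces touching it merge. If \<open>e\<close> closes a
  cycle, two of them on the same side of the resulting Jordan curve coincide; if not, all coincide.
  Either way they inject into \<open>bool\<close>.\<close>

lemma edge_touches_two_faces:
  assumes "A \<subseteq> E" "e \<in> A"
  shows "finite {F \<in> faces A. touches F e}" "card {F \<in> faces A. touches F e} \<le> 2"
proof -
  define B where "B = A - {e}"
  have B: "B \<subseteq> E" "e \<in> E" "e \<notin> B" "insert e B = A" using assms by (auto simp: B_def)
  obtain u v where uv: "e = {u, v}" using edge_cases B(2) by metis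
  define T where "T = {F \<in> faces A. touches F e}"
  have near: "connected_component (- support B) a b" if "F \<in> T" "G \<in> T" "a \<in> F" "b \<in> G" for F G a b
    using touching_faces_connected[OF B(1-3)] that unfolding B(4) T_def by blast
  have "\<exists>h :: complex set \<Rightarrow> bool. inj_on h T"
  proof (cases "(u, v) \<in> joined B")
    case True
    obtain c P where c: "simple_path c" "pathfinish c = pathstart c"
      "path_image c = P \<union> path_image (\<gamma> e)" "P \<subseteq> support B" "connected P" "p ` e \<subseteq> P"
      using closed_curve_through_edge[OF B(1) _ _ True] B uv by metis
    note J = Jordan_inside_outside[OF c(1,2)]
    have cA: "path_image c \<subseteq> support A"
      using c(3,4) B(4) by (auto simp: support_insert)
    \<comment> \<open>A face avoids the curve and is connected, so meeting the inside tells on which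
      side it lies.\<close>
    have "inj_on (\<lambda>F. F \<inter> inside (path_image c) \<noteq> {}) T"
    proof (rule inj_onI)
      fix F G assume FG: "F \<in> T" "G \<in> T"
        and eq: "(F \<inter> inside (path_image c) \<noteq> {}) = (G \<inter> inside (path_image c) \<noteq> {})"
      have FGA: "F \<in> faces A" "G \<in> faces A" using FG by (auto simp: T_def)
      have sub: "F \<subseteq> inside (path_image c) \<union> outside (path_image c)"
        "G \<subseteq> inside (path_image c) \<union> outside (path_image c)"
        using J face_props(4)[OF assms(1)] FGA cA by blast+
      obtain a b Z where "a \<in> F" "b \<in> G" "a \<in> Z" "b \<in> Z" "connected Z" "Z \<subseteq> - path_image c"
      proof (cases "F \<inter> inside (path_image c) = {}")
        case True
        obtain a b where "a \<in> F" "b \<in> G"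
          using face_props(3)[OF assms(1)] FGA by blast
        moreover have "a \<in> outside (path_image c)" "b \<in> outside (path_image c)"
          using True eq sub \<open>a \<in> F\<close> \<open>b \<in> G\<close> by blast+
        ultimately show thesis using that[of a b "outside (path_image c)"] J by blast
      next
        case False
        then obtain a b where "a \<in> F \<inter> inside (path_image c)" "b \<in> G \<inter> inside (path_image c)"
          using eq by blast
        then show thesis using that[of a b "inside (path_image c)"] J by blast
      qed
      then have ab: "a \<in> F" "b \<in> G" "connected_component (- path_image c) a b"
        by (auto simp: connected_component_def)
      have "connected_component (- support (insert e B)) a b"
        using connected_component_edge_in_cycle[OF B(1,2) c(4,5,6) B(3) _ c(3) near[OF FG ab(1,2)] ab(3)]
          c(1) simple_path_imp_path by blast
      then show "F = G" using face_eq[OF FGA ab(1,2)] B(4) by simp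
    qed
    then show ?thesis by blast
  next
    case False
    have "F = G" if FG: "F \<in> T" "G \<in> T" for F G
    proof -
      have FGA: "F \<in> faces A" "G \<in> faces A" using FG by (auto simp: T_def)
      obtain a b where ab: "a \<in> F" "b \<in> G"
        using face_props(3)[OF assms(1)] FGA by blast
      have "a \<notin> path_image (\<gamma> e)" "b \<notin> path_image (\<gamma> e)"
        using face_props(4)[OF assms(1)] FGA ab assms(2) by (auto simp: support_def)
      then have "connected_component (- support (insert e B)) a b"
        using connected_component_bridge[OF B(1) _ _ False near[OF FG ab]] B(2,3) uv by blast
      then show ?thesis using face_eq[OF FGA ab] B(4) by simp
    qed
    then show ?thesis by (auto simp: inj_on_def)
  qed
  then obtain h :: "complex set \<Rightarrow> bool" where h: "inj_on h T" by blast
  have "finite T" using inj_on_finite[OF h, of UNIV] by simp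
  moreover have "card T \<le> 2" using card_inj_on_le[OF h, of UNIV] by simp
  ultimately show "finite {F \<in> faces A. touches F e}" "card {F \<in> faces A. touches F e} \<le> 2"
    by (simp_all add: T_def)
qed

text \<open>If the bordering edges \<open>K\<close> formed a forest, their complement would be
  connected, also without the vertices. The face is open and closed in it, so it is all of it; then
  no edge lies outside \<open>K\<close>, and \<open>A\<close> would be a forest.\<close>

lemma face_boundary_not_forest:
  assumes A: "A \<subseteq> E" "\<not> forest V A" and F: "F \<in> faces A"
  shows "\<not> forest V {e \<in> A. touches F e}"
proof
  define K where "K = {e \<in> A. touches F e}"
  assume "forest V {e \<in> A. touches F e}"
  then have fo: "forest V K" by (simp add: K_def)
  have K: "K \<subseteq> E" using A by (auto simp: K_def)
  \<comment> \<open>Vertices are removed because one of them can be on the frontier of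
    \<open>F\<close> through edges outside \<open>K\<close>; every other frontier point lies on an
    open edge that \<open>F\<close> touches.\<close>
  define D where "D = - support K - p ` \<Union>A"
  have "\<Union>A \<subseteq> V" using A simple by (auto simp: simple_graph_def)
  then have "finite (\<Union>A)" using simple finite_subset by (auto simp: simple_graph_def)
  then have D: "connected D"
    unfolding D_def using connected_forest_complement[OF K fo] open_compl_support[OF K]
    by (intro connected_open_delete_finite) auto
  have ends: "p ` \<Union>A \<subseteq> support A"
    using ends_subset A(1) by (fastforce simp: support_def)
  have FD: "F \<subseteq> D"
    using face_props(4)[OF A(1) F] ends by (auto simp: D_def K_def support_def)
  have "closure F \<inter> D \<subseteq> F"
  proof
    fix x assume x: "x \<in> closure F \<inter> D"
    show "x \<in> F"
    proof (rule ccontr)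
      assume "x \<notin> F"
      then have "x \<in> frontier F"
        using x face_props(1)[OF A(1) F] by (simp add: frontier_def interior_open)
      then obtain e where e: "e \<in> A" "x \<in> path_image (\<gamma> e)"
        using face_props(5)[OF A(1) F] by (auto simp: support_def)
      then have "x \<in> open_edge e" using x by (auto simp: open_edge_def D_def)
      then have "e \<in> K" using x e by (auto simp: K_def touches_def)
      then show False using x e by (auto simp: D_def support_def)
    qed
  qed
  then have "closedin (top_of_set D) F"
    using FD closure_subset[of F] by (auto simp: closedin_closed intro!: exI[of _ "closure F"])
  moreover have "openin (top_of_set D) F"
    using FD face_props(1)[OF A(1) F] by (simp add: open_subset)
  ultimately have "F = D"
    using D face_props(3)[OF A(1) F] unfolding connected_clopen by blast
  have "A \<subseteq> K"
  proof (rule ccontr)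
    assume "\<not> A \<subseteq> K"
    then obtain e where e: "e \<in> A" "e \<notin> K" by blast
    then obtain x where x: "x \<in> open_edge e" using open_edge_nonempty A(1) by blast
    have "x \<in> support A" using x e by (auto simp: open_edge_def support_def)
    then have "x \<notin> D" using face_props(4)[OF A(1) F] \<open>F = D\<close> by blast
    moreover have "x \<notin> support K" using open_edge_disjoint[OF K _ e(2)] x e A(1) by blast
    ultimately obtain e' w where w: "e' \<in> A" "w \<in> e'" "x = p w" by (auto simp: D_def)
    have "x \<in> path_image (\<gamma> e) \<inter> p ` V" using x w \<open>\<Union>A \<subseteq> V\<close> by (auto simp: open_edge_def)
    then have "x \<in> p ` e" using edge_vertices[of e] e(1) A(1) by blast
    then show False using x by (simp add: open_edge_def)
  qed
  then have "forest V A" using forest_subset[OF fo] by blast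
  then show False using A by blast
qed

section \<open>Counting faces and edges\<close>

lemma finite_faces:
  assumes "A \<subseteq> E"
  shows "finite (faces A)"
proof (cases "forest V A")
  case True
  then have "\<forall>F\<in>faces A. \<forall>G\<in>faces A. F = G"
    using connected_forest_complement[OF assms True] components_eq_sing_iff
    by (metis faces_def components_empty connected_eq_connected_components_eq)
  then show ?thesis by (metis finite.simps is_singletonI' is_singleton_def)
next
  case False
  \<comment> \<open>Every face touches some edge, because its bordering edges contain a
    cycle.\<close>
  have "faces A \<subseteq> (\<Union>e\<in>A. {F \<in> faces A. touches F e})"
  proof
    fix F assume F: "F \<in> faces A"
    have "forest V {}" by (force simp: forest_def graph_cycle_def)
    then have "{e \<in> A. touches F e} \<noteq> {}"
      using face_boundary_not_forest[OF assms False F] by metis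
    then show "F \<in> (\<Union>e\<in>A. {F \<in> faces A. touches F e})" using F by blast
  qed
  then show ?thesis
    using edge_touches_two_faces(1)[OF assms] finite_subset[OF assms finite_edges]
    by (meson finite_UN_I finite_subset)
qed

text \<open>The map \<open>h\<close> sends each new face to the old face containing it. It is
  surjective, but not injective, since the Jordan curve through the new edge splits the face that
  contains the open edge.\<close>

lemma faces_insert_edge:
  assumes A: "A \<subseteq> E" and e: "{u, v} \<in> E" "{u, v} \<notin> A" and joined: "(u, v) \<in> joined A"
  shows "card (faces A) < card (faces (insert {u, v} A))"
proof -
  define B where "B = insert {u, v} A"
  have B: "B \<subseteq> E" "support A \<subseteq> support B" using A e by (auto simp: B_def support_def)
  obtain c P where c: "simple_path c" "pathfinish c = pathstart c"
    "path_image c = P \<union> path_image (\<gamma> {u, v})" "P \<subseteq> support A" "connected P" "p ` {u, v} \<subseteq> P"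
    using closed_curve_through_edge[OF A e joined] by metis
  note J = Jordan_inside_outside[OF c(1,2)]
  have supB: "support B = path_image c \<union> support A"
    using c(3,4) by (auto simp: B_def support_insert)
  define h where "h F = connected_component_set (- support A) (SOME x. x \<in> F)" for F
  have h: "h F = connected_component_set (- support A) x" if "F \<in> faces B" "x \<in> F" for F x
  proof -
    have "(SOME x. x \<in> F) \<in> F" using that(2) by (rule someI)
    moreover have "connected F" "F \<subseteq> - support A" using face_props[OF B(1) that(1)] B(2) by blast+
    ultimately have "connected_component (- support A) (SOME x. x \<in> F) x"
      using that(2) unfolding connected_component_def by blast
    then show ?thesis unfolding h_def using connected_component_eq_eq by (metis connected_component_in)
  qed
  define face where "face x = connected_component_set (- support B) x" for x
  have face: "face x \<in> faces B" "x \<in> face x" if "x \<notin> support B" for x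
    using that by (auto simp: face_def faces_def components_def)
  have h_face: "h (face y) = G" if "G \<in> faces A" "y \<in> G" "y \<notin> support B" for G y
    using h[OF face[OF that(3)]] face_eq_component[OF that(1,2)] by simp
  \<comment> \<open>Every point of the curve is in the closure of both its inside and its outside,
    so the open set \<open>G\<close> meets both; the points found there avoid the curve and
    \<open>support A\<close>.\<close>
  have sides: "(\<exists>y\<in>G. y \<notin> support B \<and> y \<in> inside (path_image c)) \<and>
      (\<exists>y\<in>G. y \<notin> support B \<and> y \<in> outside (path_image c))"
    if G: "G \<in> faces A" "z \<in> G" "z \<in> path_image (\<gamma> {u, v})" for G z
  proof -
    have "z \<in> closure (inside (path_image c))" "z \<in> closure (outside (path_image c))"
      using J G(3) c(3) by (auto simp: frontier_def)
    then have "G \<inter> inside (path_image c) \<noteq> {}" "G \<inter> outside (path_image c) \<noteq> {}"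
      using open_Int_closure_eq_empty[OF face_props(1)[OF A G(1)]] G(2) by auto
    then obtain y1 y2 where "y1 \<in> G \<inter> inside (path_image c)" "y2 \<in> G \<inter> outside (path_image c)"
      by blast
    moreover have "path_image c \<inter> inside (path_image c) = {}" "path_image c \<inter> outside (path_image c) = {}"
      using J by blast+
    ultimately show ?thesis
      using face_props(4)[OF A G(1)] supB by blast
  qed
  have "faces A \<subseteq> h ` faces B"
  proof
    fix G assume G: "G \<in> faces A"
    have "\<exists>y\<in>G. y \<notin> support B"
    proof (cases "G \<inter> path_image (\<gamma> {u, v}) = {}")
      case True
      then show ?thesis
        using face_props(3,4)[OF A G] by (auto simp: B_def support_insert)
    next
      case False
      then show ?thesis using sides[OF G] by blast
    qed
    then show "G \<in> h ` faces B" using h_face[OF G] face(1) by (metis imageI)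
  qed
  moreover have "h ` faces B \<subseteq> faces A"
  proof
    fix G assume "G \<in> h ` faces B"
    then obtain F where F: "F \<in> faces B" "G = h F" by blast
    obtain x where x: "x \<in> F" using face_props(3)[OF B(1) F(1)] by blast
    then have "x \<notin> support A" using face_props(4)[OF B(1) F(1)] B(2) by blast
    then show "G \<in> faces A" using h[OF F(1) x] F(2) by (auto simp: faces_def components_def)
  qed
  ultimately have im: "h ` faces B = faces A" by blast
  have "\<not> inj_on h (faces B)"
  proof
    assume inj: "inj_on h (faces B)"
    obtain z where z: "z \<in> open_edge {u, v}" using open_edge_nonempty[OF e(1)] by blast
    then have zA: "z \<notin> support A" "z \<in> path_image (\<gamma> {u, v})"
      using open_edge_disjoint[OF A e] by (auto simp: open_edge_def)
    define G where "G = connected_component_set (- support A) z"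
    have G: "G \<in> faces A" "z \<in> G" using zA by (auto simp: G_def faces_def components_def)
    obtain y1 y2 where y: "y1 \<in> G" "y1 \<notin> support B" "y1 \<in> inside (path_image c)"
      "y2 \<in> G" "y2 \<notin> support B" "y2 \<in> outside (path_image c)"
      using sides[OF G zA(2)] by blast
    \<comment> \<open>Both new faces lie in \<open>G\<close>, so injectivity would identify them,
      giving a connected set that avoids the curve but meets both sides.\<close>
    have "face y1 = face y2"
      using inj_onD[OF inj _ face(1) face(1)] h_face[OF G(1)] y by simp
    then have "y1 \<in> face y1" "y2 \<in> face y1" using face(2) y by auto
    moreover have "connected (face y1)" "face y1 \<inter> path_image c = {}"
      using face_props(2,4)[OF B(1) face(1)[OF y(2)]] supB by blast+
    ultimately show False
      using connectedD[of "face y1" "inside (path_image c)" "outside (path_image c)"] J y by blast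
  qed
  then have "card (h ` faces B) \<noteq> card (faces B)"
    using eq_card_imp_inj_on[OF finite_faces[OF B(1)]] by blast
  then have "card (h ` faces B) < card (faces B)"
    using card_image_le[OF finite_faces[OF B(1)], of h] by linarith
  then show ?thesis using im by (simp add: B_def)
qed

text \<open>One half of Euler's formula: there is a face to begin with, as a compact support does
  not fill the plane, and each edge of \<open>A\<close> closes a cycle with \<open>T\<close> and
  adds a face.\<close>

lemma faces_lower_bound:
  assumes "finite A" "T \<union> A \<subseteq> E" "T \<inter> A = {}"
    and "\<And>u v. {u, v} \<in> A \<Longrightarrow> (u, v) \<in> joined T"
  shows "card A < card (faces (T \<union> A))"
  using assms
proof (induction A rule: finite_induct)
  case empty
  have "support T \<noteq> UNIV"
    using compact_support[of T] empty.prems(1) not_compact_UNIV[where ?'a = complex] by auto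
  then have "faces T \<noteq> {}" by (auto simp: faces_def components_eq_empty)
  then show ?case using finite_faces[of T] empty by (simp add: card_gt_0_iff)
next
  case (insert e A)
  have sub: "T \<union> A \<subseteq> E" "e \<in> E" "e \<notin> T \<union> A" using insert by auto
  obtain u v where uv: "e = {u, v}" using edge_cases sub(2) by metis
  have "(u, v) \<in> joined T" using insert.prems(3) uv by blast
  then have "(u, v) \<in> joined (T \<union> A)" by (rule rtrancl_mono[THEN subsetD, rotated]) auto
  then have "card (faces (T \<union> A)) < card (faces (insert e (T \<union> A)))"
    unfolding uv using faces_insert_edge sub uv by blast
  moreover have "card A < card (faces (T \<union> A))" using insert by blast
  ultimately show ?case using insert.hyps by simp
qed

theorem edge_bound:
  assumes "V \<noteq> {}" and cycles: "\<And>c. graph_cycle V E c \<Longrightarrow> 5 \<le> length c"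
  shows "3 * card E < 5 * card V"
proof -
  have finV: "finite V" using simple by (simp add: simple_graph_def)
  then have V: "0 < card V" using assms(1) by (simp add: card_gt_0_iff)
  show ?thesis
  proof (cases "forest V E")
    case True
    then show ?thesis using forest_card_edges_le[OF simple] V by simp
  next
    case False
    \<comment> \<open>A maximal forest \<open>T\<close> joins the ends of every other edge, since
      adding that edge creates a cycle.\<close>
    define M where "M = {T. T \<subseteq> E \<and> forest V T}"
    have "finite M" using finite_edges by (simp add: M_def)
    moreover have "{} \<in> M" by (force simp: M_def forest_def graph_cycle_def)
    ultimately obtain T where TM: "T \<in> M" and max: "\<forall>T'\<in>M. T \<subseteq> T' \<longrightarrow> T = T'"
      using finite_has_maximal[of M] by blast
    have T: "T \<subseteq> E" "forest V T" using TM by (auto simp: M_def)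
    have cT: "card T \<le> card V"
      using forest_card_edges_le[OF simple_graph_subset[OF simple T(1)] T(2)] .
    have "(u, v) \<in> joined T" if uv: "{u, v} \<in> E - T" for u v
    proof -
      have "insert {u, v} T \<notin> M" using max uv by blast
      then have "\<not> forest V (insert {u, v} T)" using uv T(1) by (simp add: M_def)
      then show ?thesis using joined_if_graph_cycle[OF T(2)] by (auto simp: forest_def)
    qed
    then have "card (E - T) < card (faces (T \<union> (E - T)))"
      using T(1) finite_edges by (intro faces_lower_bound) auto
    moreover have "T \<union> (E - T) = E" using T(1) by blast
    moreover have "card (E - T) = card E - card T"
      using T(1) finite_edges by (simp add: card_Diff_subset finite_subset)
    ultimately have lower: "card E < card (faces E) + card V" using cT by simp
    \<comment> \<open>The edges bordering a face contain a cycle, and its at least five edges are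
      distinct.\<close>
    have five: "5 \<le> card {e \<in> E. touches F e}" if F: "F \<in> faces E" for F
    proof -
      obtain c where c: "graph_cycle V {e \<in> E. touches F e} c"
        using face_boundary_not_forest[OF order_refl False F] by (auto simp: forest_def)
      then have "graph_cycle V E c" by (auto simp: graph_cycle_def)
      then show ?thesis using cycles graph_cycle_length_le[OF c] finite_edges by fastforce
    qed
    \<comment> \<open>Counting incidences of faces and edges in two ways gives 5 |F| \<le> 2 |E|;
      with |E| < |F| + |V| this yields the claim.\<close>
    have "5 * card (faces E) = (\<Sum>F\<in>faces E. 5)" by simp
    also have "\<dots> \<le> (\<Sum>F\<in>faces E. card {e \<in> E. touches F e})"
      using five by (intro sum_mono)
    also have "\<dots> = (\<Sum>F\<in>faces E. \<Sum>e\<in>{e \<in> E. touches F e}. 1)" by simp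
    also have "\<dots> = (\<Sum>e\<in>E. \<Sum>F\<in>{F \<in> faces E. touches F e}. 1)"
      by (rule sum.swap_restrict[OF finite_faces[OF order_refl] finite_edges])
    also have "\<dots> \<le> (\<Sum>e\<in>E. 2)"
      using edge_touches_two_faces(2)[OF order_refl] by (intro sum_mono) simp
    finally show ?thesis using lower by simp
  qed
qed

end

section \<open>Planar graphs of girth at least five\<close>

lemma girth_le_length: "graph_cycle V E c \<Longrightarrow> girth V E \<le> enat (length c)"
  unfolding girth_def by (rule Inf_lower) blast

lemma plane_graph_induced:
  assumes "plane_graph V E p \<gamma>" "W \<subseteq> V"
  shows "plane_graph W (induced_edges E W) p \<gamma>"
proof
  interpret plane_graph V E p \<gamma> by fact
  show "simple_graph W (induced_edges E W)"
    using simple finite_subset[OF assms(2)] by (auto simp: simple_graph_def induced_edges_def)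
  have "path_image (\<gamma> e) \<inter> p ` W = p ` e" if "e \<in> E" "e \<subseteq> W" for e
    using edge_vertices[OF that(1)] that(2) assms(2) by blast
  moreover have "inj_on p W"
    using drawing inj_on_subset[OF _ assms(2)] by (auto simp: plane_drawing_def)
  ultimately show "plane_drawing W (induced_edges E W) p \<gamma>"
    using drawing by (simp add: plane_drawing_def induced_edges_def)
qed

theorem theorem3p5:
  fixes V :: "'a set" and E :: "'a set set"
  assumes "simple_graph V E"
    and "planar V E"
    and "5 \<le> girth V E"
  shows "(\<forall>t\<ge>3. \<exists>f. equitable_tree_coloring V E t f) \<and> va_equiv V E \<le> 3"
proof -
  obtain p \<gamma> where "plane_drawing V E p \<gamma>" using assms(2) by (auto simp: planar_def)
  then have plane: "plane_graph V E p \<gamma>" using assms(1) by (simp add: plane_graph_def)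
  have long: "5 \<le> length c" if "graph_cycle V E c" for c
    using order_trans[OF assms(3) girth_le_length[OF that]] by (simp add: numeral_eq_enat)
  interpret sparse_graph V E
  proof
    show "simple_graph V E" by fact
  next
    fix x y z assume xyz: "{x, y} \<in> E" "{y, z} \<in> E"
    show "{x, z} \<notin> E"
    proof
      assume xz: "{x, z} \<in> E"
      have "distinct [x, y, z]"
        using xyz xz simple_graph_no_loop[OF assms(1)] by auto
      moreover have "set [x, y, z] \<subseteq> V" using xyz xz assms(1) by (auto simp: simple_graph_def)
      ultimately have "graph_cycle V E [x, y, z]"
        using xyz xz by (intro graph_cycleI) (auto simp: insert_commute)
      then show False using long by fastforce
    qed
  next
    fix W assume W: "W \<subseteq> V" "W \<noteq> {}"
    have "graph_cycle V E c" if "graph_cycle W (induced_edges E W) c" for c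
      using that W(1) unfolding graph_cycle_def induced_edges_def by blast
    then show "3 * card (induced_edges E W) < 5 * card W"
      using plane_graph.edge_bound[OF plane_graph_induced[OF plane W(1)] W(2)] long by blast
  qed
  have "\<forall>t\<ge>3. \<exists>f. equitable_tree_coloring V E t f"
    using equitable_tree_coloring_exists by blast
  \<comment> \<open>The number 3 is positive and satisfies the condition whose least solution
    defines \<open>va_equiv\<close>.\<close>
  moreover from this have "va_equiv V E \<le> 3"
    unfolding va_equiv_def by (intro Least_le) simp
  ultimately show ?thesis by blast
qed

end
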